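(* Let $A\in\mathbb{C}^{n\times n}$ be skew-Hermitian, let $B\in\mathbb{C}^{n\times m}$, and let $A_{\mathrm{cl.loop}}$ be the closed-loop matrix of the associated linear quadratic regulator problem, with $\lambda_k$, $b_k$, $\delta_k$, $\Delta$ as in the context. Put $$\ell_{est}=\min_{1\le k\le n}\frac{\|b_k\|}{\sqrt2\,\bigl(1+2\frac{\|B\|^2}{\delta_k^2}\bigr)},\qquad \ell^1_{est}=\min_{1\le k\le n}\frac{\|b_k\|}{\sqrt2\,\sqrt{1+2\frac{\|B\|^2}{\delta_k^2}}}.$$ Then: (1) The eigenvalues of $A_{\mathrm{cl.loop}}$ lie in the box $[-\|B\|,-\ell_{est})\times[\lambda_1,\lambda_n]$. (2) If moreover the smallest singular value $\sigma_m$ of $B$ satisfies $\sigma_m>2\sqrt2\,\Delta$, then exactly $m$ eigenvalues of $A_{\mathrm{cl.loop}}$ (counted with multiplicity) lie in the box $[-\|B\|,-\frac{\sqrt6}{4}\sigma_m]\times[\lambda_1,\lambda_n]$, and the other $n-m$ eigenvalues lie in the box $(-\sqrt3\,\Delta,-\ell_{est})\times[\lambda_1,\lambda_n]$. (3) If $m=1$, then assertions (1) and (2) hold with $\ell_{est}$ replaced by the larger number $\ell^1_{est}$.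
   Context: Standing setting: $n\ge 2$, $1\le m\le n$; $A\in\mathbb{C}^{n\times n}$ is skew-Hermitian ($A^*=-A$); $B\in\mathbb{C}^{n\times m}$ with $\ker B=\{0\}$; the pair $(A,B)$ is stabilizable (equivalently, since $A$ is skew-Hermitian, controllable). $\|\cdot\|$ is the Euclidean norm of vectors and the induced operator norm of matrices. Linear quadratic regulator: for $x'(t)=Ax(t)+Bu(t)$, $x(0)=x_0$, minimize $J^u(x_0)=\int_0^\infty x(t)^*x(t)+u(t)^*u(t)\,dt$. The optimal control is $u=-Fx$, $F=B^*X$, where $X$ is the unique nonnegative (in fact positive definite) solution of $XBB^*X-XA-A^*X-I=0$. The closed-loop matrix is $A_{\mathrm{cl.loop}}=A-BF=A-BB^*X$; it is stable (its spectrum lies in $\{\operatorname{Re} z<0\}$). Notation: the eigenvalues of $A$, listed with multiplicity, are $i\lambda_1,\dots,i\lambda_n$ with $\lambda_1\le\dots\le\lambda_n$ real; $v_1,\dots,v_n$ is an orthonormal basis of $\mathbb{C}^n$ with $Av_j=i\lambda_jv_j$; $b_j=B^*v_j$; $\delta_k=\min_{j\ne k}|\lambda_j-\lambda_k|$; $\Delta=\lambda_n-\lambda_1$. If $A$ has multiple eigenvalues, put $\ell_{est}=\ell^1_{est}=0$. A box $I\times J$ denotes $\{z\in\mathbb{C}:\operatorname{Re} z\in I,\ \operatorname{Im} z\in J\}$. *)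

theory Defs
  imports "HOL-Analysis.Analysis" "HOL-Computational_Algebra.Computational_Algebra"
begin

definition adj :: "complex^'m^'n \<Rightarrow> complex^'n^'m"
  where "adj M = (\<chi> i j. cnj (M $ j $ i))"

text \<open>The inner product of the library on \<^typ>\<open>complex^'n\<close> is the real one, i.e. the real
  part of the Hermitian product \<open>x* y\<close> defined here. Both induce the Euclidean norm.\<close>

definition cprod :: "complex^'n \<Rightarrow> complex^'n \<Rightarrow> complex"
  where "cprod x y = (\<Sum>i\<in>UNIV. cnj (x $ i) * y $ i)"

definition eigenvalue :: "complex^'n^'n \<Rightarrow> complex \<Rightarrow> bool"
  where "eigenvalue M z \<longleftrightarrow> (\<exists>x. x \<noteq> 0 \<and> M *v x = z *s x)"

definition charpoly :: "complex^'n^'n \<Rightarrow> complex poly"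
  where "charpoly M = det (\<chi> i j. (if i = j then [:0, 1:] else 0) - [:M $ i $ j:])"

text \<open>The eigenvalues with algebraic multiplicity.\<close>

definition eigvals :: "complex^'n^'n \<Rightarrow> complex multiset"
  where "eigvals M = proots (charpoly M)"

definition singular_value :: "complex^'m^'n \<Rightarrow> real \<Rightarrow> bool"
  where "singular_value B s \<longleftrightarrow> 0 \<le> s \<and> eigenvalue (adj B ** B) (complex_of_real (s\<^sup>2))"

text \<open>Used for \<open>m \<le> n\<close>, when the \<open>m\<close> singular values of an \<open>n \<times> m\<close> matrix are exactly the
  square roots of the \<open>m\<close> eigenvalues of \<open>B* B\<close>.\<close>

definition smallest_singular_value :: "complex^'m^'n \<Rightarrow> real"
  where "smallest_singular_value B = Min {s. singular_value B s}"

abbreviation opnorm :: "complex^'m^'n \<Rightarrow> real"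
  where "opnorm M \<equiv> onorm ((*v) M)"

definition complex_box :: "real set \<Rightarrow> real set \<Rightarrow> complex set"
  where "complex_box I J = {z. Re z \<in> I \<and> Im z \<in> J}"

definition skew_hermitian :: "complex^'n^'n \<Rightarrow> bool"
  where "skew_hermitian A \<longleftrightarrow> adj A = - A"

definition nonneg_matrix :: "complex^'n^'n \<Rightarrow> bool"
  where "nonneg_matrix X \<longleftrightarrow> adj X = X \<and> (\<forall>x. 0 \<le> Re (cprod x (X *v x)))"

definition stable :: "complex^'n^'n \<Rightarrow> bool"
  where "stable M \<longleftrightarrow> (\<forall>z. eigenvalue M z \<longrightarrow> Re z < 0)"

definition stabilizable :: "complex^'n^'n \<Rightarrow> complex^'m^'n \<Rightarrow> bool"
  where "stabilizable A B \<longleftrightarrow> (\<exists>F :: complex^'n^'m. stable (A - B ** F))"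

text \<open>For stabilizable \<open>(A, B)\<close> there is exactly one such \<open>X\<close>, and \<open>u = - B* X x\<close> is the
  optimal control for the cost \<open>\<integral> x* x + u* u\<close>.\<close>

definition lqr_riccati_solution :: "complex^'n^'n \<Rightarrow> complex^'m^'n \<Rightarrow> complex^'n^'n \<Rightarrow> bool"
  where "lqr_riccati_solution A B X \<longleftrightarrow>
    nonneg_matrix X \<and> X ** B ** adj B ** X - X ** A - adj A ** X - mat 1 = 0"

definition closed_loop :: "complex^'n^'n \<Rightarrow> complex^'m^'n \<Rightarrow> complex^'n^'n \<Rightarrow> complex^'n^'n"
  where "closed_loop A B X = A - B ** (adj B ** X)"

text \<open>Eigenvalues and eigenvectors are indexed by \<open>1, \<dots>, n\<close> with \<open>n = CARD('n)\<close>; values at other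
  indices are irrelevant. The \<open>n\<close> orthonormal vectors automatically form a basis, so that
  \<open>\<i> lam 1, \<dots>, \<i> lam n\<close> lists all eigenvalues of \<open>A\<close> with multiplicity.\<close>

definition skew_eigenbasis ::
    "complex^'n^'n \<Rightarrow> (nat \<Rightarrow> real) \<Rightarrow> (nat \<Rightarrow> complex^'n) \<Rightarrow> bool"
  where "skew_eigenbasis A lam v \<longleftrightarrow>
    mono_on {1..CARD('n)} lam \<and>
    (\<forall>j\<in>{1..CARD('n)}. A *v v j = (\<i> * complex_of_real (lam j)) *s v j) \<and>
    (\<forall>j\<in>{1..CARD('n)}. \<forall>k\<in>{1..CARD('n)}. cprod (v j) (v k) = (if j = k then 1 else 0))"

definition eig_gap :: "nat \<Rightarrow> (nat \<Rightarrow> real) \<Rightarrow> nat \<Rightarrow> real"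
  where "eig_gap n lam k = Min ((\<lambda>j. \<bar>lam j - lam k\<bar>) ` ({1..n} - {k}))"

definition l_est :: "complex^'m^'n \<Rightarrow> (nat \<Rightarrow> real) \<Rightarrow> (nat \<Rightarrow> complex^'n) \<Rightarrow> real"
  where "l_est B lam v =
    (if inj_on lam {1..CARD('n)}
     then Min ((\<lambda>k. norm (adj B *v v k) /
            (sqrt 2 * (1 + 2 * ((opnorm B)\<^sup>2 / (eig_gap CARD('n) lam k)\<^sup>2)))) ` {1..CARD('n)})
     else 0)"

definition l1_est :: "complex^'m^'n \<Rightarrow> (nat \<Rightarrow> real) \<Rightarrow> (nat \<Rightarrow> complex^'n) \<Rightarrow> real"
  where "l1_est B lam v =
    (if inj_on lam {1..CARD('n)}
     then Min ((\<lambda>k. norm (adj B *v v k) /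
            (sqrt 2 * sqrt (1 + 2 * ((opnorm B)\<^sup>2 / (eig_gap CARD('n) lam k)\<^sup>2)))) ` {1..CARD('n)})
     else 0)"

text \<open>The two notions of eigenvalue agree.\<close>

lemma poly_det: "poly (det M) z = det (\<chi> i j. poly (M $ i $ j) z)" for M :: "complex poly^'n^'n"
  by (simp add: det_def poly_sum poly_prod)

lemma eigenvalue_iff_poly: "poly (charpoly M) z = 0 \<longleftrightarrow> eigenvalue M z"
proof -
  have eq: "(\<chi> i j. poly ((\<chi> i j. (if i = j then [:0, 1:] else 0) - [:M $ i $ j:]) $ i $ j) z)
      = mat z - M"
    by (auto simp: vec_eq_iff mat_def)
  have smult: "mat z *v x = z *s x" for x :: "complex^'n"
    by (simp add: vec_eq_iff mat_def matrix_vector_mult_def if_distrib[of "\<lambda>a. a * _"] cong: if_cong)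
  have "poly (charpoly M) z = det (mat z - M)"
    unfolding charpoly_def poly_det eq ..
  also have "\<dots> = 0 \<longleftrightarrow> \<not> invertible (mat z - M)"
    by (simp add: invertible_det_nz)
  also have "\<dots> \<longleftrightarrow> (\<exists>x. x \<noteq> 0 \<and> (mat z - M) *v x = 0)"
    unfolding invertible_left_inverse matrix_left_invertible_ker by auto
  also have "\<dots> \<longleftrightarrow> eigenvalue M z"
    unfolding eigenvalue_def by (auto simp: matrix_vector_mult_diff_rdistrib smult)
  finally show ?thesis .
qed

lemma eigenvalue_norm_le:
  assumes "eigenvalue M z" shows "norm z \<le> opnorm M"
proof -
  obtain x where x: "x \<noteq> 0" "M *v x = z *s x"
    using assms unfolding eigenvalue_def by blast
  have "norm (z *s x) = norm z * norm x"
    by (simp add: norm_vec_def norm_mult L2_set_right_distrib vector_scalar_mult_def)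
  moreover have "bounded_linear ((*v) M)"
    by (rule matrix_vector_mul_bounded_linear)
  then have "norm (M *v x) \<le> opnorm M * norm x"
    by (rule onorm)
  ultimately show ?thesis
    using x by simp
qed

lemma charpoly_nonzero: "charpoly M \<noteq> 0"
proof
  assume "charpoly M = 0"
  then have "eigenvalue M z" for z
    using eigenvalue_iff_poly[of M z] by simp
  then have "norm (complex_of_real (\<bar>opnorm M\<bar> + 1)) \<le> opnorm M"
    by (rule eigenvalue_norm_le)
  then show False
    unfolding norm_of_real by linarith
qed

lemma in_eigvals_iff: "z \<in># eigvals M \<longleftrightarrow> eigenvalue M z"
  by (simp add: eigvals_def charpoly_nonzero eigenvalue_iff_poly)

end

theory Submission
  imports Defs
begin

text \<open>
  Multiplying the Riccati equation by an eigenvector \<open>x\<close> of the closed loop shows that \<open>y = X x\<close>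
  solves the quadratic eigenvalue problem \<open>(A - z)\<^sup>2 y = B B* y\<close>. Testing it with \<open>y\<close> and reading it in
  the eigenbasis of \<open>A\<close>, with \<open>z = - r + \<i> s\<close>, exhibits \<open>s\<close> as the mean of the \<open>\<lambda>\<^sub>j\<close> under the weights
  \<open>|y\<^sub>j|\<^sup>2\<close> and \<open>r\<^sup>2\<close> as their variance plus \<open>\<parallel>B* y\<parallel>\<^sup>2\<close>. The lower bounds for \<open>r\<close> come from separating
  the component whose \<open>\<lambda>\<^sub>k\<close> is nearest to \<open>s\<close>; for \<open>r \<ge> \<surd>3 \<Delta>\<close> the component of \<open>y\<close> in \<open>ker B*\<close> is
  small, which forces \<open>r \<ge> (\<surd>6 / 4) \<sigma>\<close>.

  For the multiplicities put \<open>Y = X\<^sup>-\<^sup>1\<close>. Then \<open>(A + Y - z) (A - Y - z) = (A - z)\<^sup>2 - B B*\<close>, the closed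
  loop is similar to \<open>A - Y\<close>, and \<open>A + Y\<close> has no spectrum in the left half-plane. So one has to count
  the roots of \<open>det ((A - z)\<^sup>2 - B B*)\<close> beyond the gap just found; the gap persists when \<open>A\<close> is
  replaced by \<open>t A\<close>, so the count is the same as for \<open>t = 0\<close>.
\<close>

unbundle no Formal_Power_Series.fps_syntax

section \<open>Hermitian products, adjoints and operator norms\<close>

lemma cprod_add: "cprod x (y + z) = cprod x y + cprod x z" "cprod (x + y) z = cprod x z + cprod y z"
  by (simp_all add: cprod_def algebra_simps sum.distrib)

lemma cprod_diff: "cprod x (y - z) = cprod x y - cprod x z" "cprod (x - y) z = cprod x z - cprod y z"
  by (simp_all add: cprod_def algebra_simps sum_subtractf)

lemma cprod_minus: "cprod x (- y) = - cprod x y" "cprod (- x) y = - cprod x y"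
  by (simp_all add: cprod_def sum_negf)

lemma cprod_scale: "cprod x (c *s y) = c * cprod x y" "cprod (c *s x) y = cnj c * cprod x y"
  by (simp_all add: cprod_def sum_distrib_left mult_ac)

lemma cprod_zero [simp]: "cprod x 0 = 0" "cprod 0 x = 0"
  by (simp_all add: cprod_def)

lemma cprod_sum: "cprod x (\<Sum>i\<in>I. f i) = (\<Sum>i\<in>I. cprod x (f i))"
  by (induction I rule: infinite_finite_induct) (auto simp: cprod_add)

lemma cnj_cprod: "cnj (cprod x y) = cprod y x"
  by (simp add: cprod_def mult.commute)

lemma norm_vec_sq: "(norm (x :: complex^'n))\<^sup>2 = (\<Sum>i\<in>UNIV. (cmod (x $ i))\<^sup>2)"
  by (simp add: norm_vec_def L2_set_def sum_nonneg)

lemma cprod_self: "cprod x x = complex_of_real ((norm x)\<^sup>2)"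
proof -
  have "cnj z * z = complex_of_real ((cmod z)\<^sup>2)" for z
    by (metis complex_norm_square mult.commute of_real_power)
  then show ?thesis
    by (simp add: cprod_def norm_vec_sq del: of_real_power)
qed

lemma norm_cprod_le: "cmod (cprod x y) \<le> norm x * norm y"
proof -
  have "cmod (cprod x y) \<le> (\<Sum>i\<in>UNIV. \<bar>cmod (x $ i)\<bar> * \<bar>cmod (y $ i)\<bar>)"
    unfolding cprod_def by (rule order_trans[OF norm_sum]) (simp add: norm_mult)
  also have "\<dots> \<le> norm x * norm y"
    unfolding norm_vec_def by (rule L2_set_mult_ineq)
  finally show ?thesis .
qed

lemma norm_vec_scale: "norm (c *s x :: complex^'n) = cmod c * norm x"
  by (simp add: norm_vec_def norm_mult L2_set_right_distrib vector_scalar_mult_def)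

lemma adj_adj [simp]: "adj (adj M) = M"
  by (simp add: adj_def vec_eq_iff)

lemma cprod_adj: "cprod x (M *v y) = cprod (adj M *v x) y"
  unfolding cprod_def adj_def matrix_vector_mult_def
  by (simp add: sum_distrib_left sum_distrib_right mult_ac) (rule sum.swap)

lemma cprod_adj_right: "cprod x (adj M *v y) = cprod (M *v x) y"
  by (simp add: cprod_adj)

lemma norm_mult_le_opnorm: "norm (B *v u) \<le> opnorm B * norm u" for B :: "complex^'m^'n"
  by (rule onorm) (rule matrix_vector_mul_bounded_linear)

lemma opnorm_nonneg: "0 \<le> opnorm (B :: complex^'m^'n)"
  by (rule onorm_pos_le) (rule matrix_vector_mul_bounded_linear)

text \<open>The squared norm of \<open>adj B *v y\<close> is the product of \<open>y\<close> with
  \<open>B *v (adj B *v y)\<close>; after Cauchy-Schwarz one factor cancels.\<close>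

lemma norm_adj_mult_le: "norm (adj B *v y) \<le> opnorm B * norm y" for B :: "complex^'m^'n"
proof -
  have "(norm (adj B *v y))\<^sup>2 = cmod (cprod y (B *v (adj B *v y)))"
    by (simp add: cprod_adj cprod_self norm_power)
  also have "\<dots> \<le> norm y * (opnorm B * norm (adj B *v y))"
    by (rule order_trans[OF norm_cprod_le mult_left_mono[OF norm_mult_le_opnorm]]) simp
  finally have "norm (adj B *v y) * norm (adj B *v y) \<le> (opnorm B * norm y) * norm (adj B *v y)"
    by (simp add: power2_eq_square mult_ac)
  then show ?thesis
    by (cases "norm (adj B *v y) = 0") (auto simp: opnorm_nonneg)
qed

lemma matrix_vector_scale: "(M :: complex^'m^'n) *v (c *s x) = c *s (M *v x)"
  by (simp add: vector_scalar_commute)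

lemma matrix_vector_minus: "(- M) *v x = - (M *v x)" for M :: "complex^'m^'n"
  by (simp add: vec_eq_iff matrix_vector_mult_def sum_negf)

lemma mat_mult_scale: "mat c *v x = c *s (x :: complex^'n)"
  by (simp add: vec_eq_iff mat_def matrix_vector_mult_def if_distrib[of "\<lambda>a. a * _"] cong: if_cong)

subsection \<open>Orthonormal eigenbases\<close>

locale eigenbasis =
  fixes A :: "complex^'n^'n" and lam :: "nat \<Rightarrow> real" and v :: "nat \<Rightarrow> complex^'n" and n :: nat
  assumes skew: "adj A = - A" and eig: "skew_eigenbasis A lam v" and n_def: "n = CARD('n)"
begin

lemma A_v: "j \<in> {1..n} \<Longrightarrow> A *v v j = (\<i> * complex_of_real (lam j)) *s v j"
  and orth: "j \<in> {1..n} \<Longrightarrow> k \<in> {1..n} \<Longrightarrow> cprod (v j) (v k) = (if j = k then 1 else 0)"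
  using eig unfolding skew_eigenbasis_def n_def by blast+

lemma norm_v: "j \<in> {1..n} \<Longrightarrow> norm (v j) = 1"
  using orth[of j j] cprod_self[of "v j"] norm_ge_zero[of "v j"]
  by (simp add: power2_eq_1_iff flip: of_real_power)

lemma lam_mono: "1 \<le> j \<Longrightarrow> j \<le> k \<Longrightarrow> k \<le> n \<Longrightarrow> lam j \<le> lam k"
  using eig unfolding skew_eigenbasis_def n_def mono_on_def by auto

lemma n_pos: "1 \<le> n"
  unfolding n_def by (simp add: Suc_leI)

text \<open>The matrix \<open>V\<close> with columns \<open>v (h i)\<close> is square, so its left
  inverse \<open>adj V\<close>, given by orthonormality, is also a right inverse, and that is
  completeness. The bijection \<open>h\<close> carries the index type \<open>'n\<close> to
  \<open>{1..n}\<close>.\<close>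

lemma expansion: "x = (\<Sum>j\<in>{1..n}. cprod (v j) x *s v j)"
proof -
  obtain h where h: "bij_betw h (UNIV :: 'n set) {1..n}"
    using bij_betw_inv_into ex_bij_betw_nat_finite_1[OF finite_class.finite_UNIV] unfolding n_def by blast
  have hin: "h i \<in> {1..n}" for i
    using bij_betwE[OF h] by blast
  define V :: "complex^'n^'n" where "V = (\<chi> i j. v (h j) $ i)"
  have "adj V ** V = mat 1"
  proof -
    have "(adj V ** V) $ i $ j = cprod (v (h i)) (v (h j))" for i j
      by (simp add: matrix_matrix_mult_def adj_def V_def cprod_def)
    moreover have "h i = h j \<longleftrightarrow> i = j" for i j
      using bij_betw_imp_inj_on[OF h] by (simp add: inj_eq)
    ultimately show ?thesis
      using orth[OF hin hin] by (simp add: vec_eq_iff mat_def)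
  qed
  then have "V ** adj V = mat 1"
    using matrix_left_right_inverse by blast
  then have "x = V *v (adj V *v x)"
    by (simp add: matrix_vector_mul_assoc)
  also have "\<dots> = (\<Sum>i\<in>UNIV. cprod (v (h i)) x *s v (h i))"
    by (simp add: vec_eq_iff matrix_vector_mult_def V_def adj_def cprod_def mult.commute)
  also have "\<dots> = (\<Sum>j\<in>{1..n}. cprod (v j) x *s v j)"
    by (rule sum.reindex_bij_betw[OF h, of "\<lambda>j. cprod (v j) x *s v j"])
  finally show ?thesis .
qed

lemma parseval: "cprod x y = (\<Sum>j\<in>{1..n}. cnj (cprod (v j) x) * cprod (v j) y)"
proof -
  have "cprod x y = cprod x (\<Sum>j\<in>{1..n}. cprod (v j) y *s v j)"
    using expansion[of y] by simp
  then show ?thesis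
    by (simp add: cprod_sum cprod_scale cnj_cprod mult.commute)
qed

lemma parseval_norm: "(norm x)\<^sup>2 = (\<Sum>j\<in>{1..n}. (cmod (cprod (v j) x))\<^sup>2)"
proof -
  have "cnj z * z = complex_of_real ((cmod z)\<^sup>2)" for z
    by (metis complex_norm_square mult.commute of_real_power)
  then have "complex_of_real ((norm x)\<^sup>2) = complex_of_real (\<Sum>j\<in>{1..n}. (cmod (cprod (v j) x))\<^sup>2)"
    using parseval[of x x] unfolding cprod_self by simp
  then show ?thesis
    using of_real_eq_iff by blast
qed

lemma coord_A: "j \<in> {1..n} \<Longrightarrow> cprod (v j) (A *v x) = \<i> * complex_of_real (lam j) * cprod (v j) x"
  by (simp add: cprod_adj skew A_v cprod_scale cprod_minus matrix_vector_minus)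

end

lemma eig_gap_le:
  assumes "k \<in> {1..n}" "j \<in> {1..n}" "j \<noteq> k"
  shows "eig_gap n lam k \<le> \<bar>lam j - lam k\<bar>"
  unfolding eig_gap_def using assms by (intro Min_le) auto


lemma eig_gap_pos:
  assumes "k \<in> {1..n}" "2 \<le> n" "inj_on lam {1..n}"
  shows "0 < eig_gap n lam k"
proof -
  \<comment> \<open>A second index exists because \<open>2 \<le> n\<close>, so the minimum ranges
    over a nonempty set.\<close>
  have "(if k = 1 then 2 else 1) \<in> {1..n} - {k}"
    using assms by auto
  then have "{1..n} - {k} \<noteq> {}"
    by blast
  moreover have "lam j \<noteq> lam k" if "j \<in> {1..n} - {k}" for j
    using that assms inj_onD by fastforce
  ultimately show ?thesis
    unfolding eig_gap_def by (subst Min_gr_iff) auto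
qed

subsection \<open>The quadratic pencil\<close>

text \<open>The Riccati solution is left out of the locale so that the bounds also apply to the
  matrices \<open>t *\<^sub>R A\<close> of the homotopy.\<close>

locale pencil = eigenbasis A lam v n for A :: "complex^'n^'n" and lam v n +
  fixes B :: "complex^'m^'n" and y :: "complex^'n" and z :: complex
  assumes norm_y: "norm y = 1" and Re_z: "Re z < 0"
    and pencil: "A *v (A *v y) - (2 * z) *s (A *v y) + z\<^sup>2 *s y = B *v (adj B *v y)"
begin

abbreviation "r \<equiv> - Re z"
abbreviation "s \<equiv> Im z"
abbreviation "w \<equiv> adj B *v y"
abbreviation "c j \<equiv> cprod (v j) y"

lemma r_pos: "0 < r"
  using Re_z by simp

lemma shift: "\<i> * complex_of_real t - z = Complex r (t - s)"
  by (simp add: complex_eq_iff)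

lemma norm_shift_sq: "cmod ((\<i> * complex_of_real t - z)\<^sup>2) = (t - s)\<^sup>2 + r\<^sup>2"
  unfolding shift norm_power by (simp add: cmod_power2)

text \<open>Pairing the pencil equation with \<open>v j\<close> decouples it, since \<open>A\<close>
  acts there as the scalar \<open>\<i> * lam j\<close>.\<close>

lemma coord:
  assumes "j \<in> {1..n}"
  shows "(\<i> * complex_of_real (lam j) - z)\<^sup>2 * c j = cprod (adj B *v v j) w"
proof -
  have "cprod (adj B *v v j) w = cprod (v j) (B *v w)"
    by (simp add: cprod_adj)
  also have "\<dots> = (\<i> * complex_of_real (lam j) - z)\<^sup>2 * c j"
    using assms unfolding pencil[symmetric]
    by (simp add: cprod_add cprod_diff cprod_scale coord_A algebra_simps power2_eq_square)
  finally show ?thesis ..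
qed

lemma sum_c: "(\<Sum>j\<in>{1..n}. (cmod (c j))\<^sup>2) = 1"
  using parseval_norm[of y] norm_y by simp

text \<open>The pencil equation is paired with \<open>y\<close> and expanded by Parseval. The right
  side being real, the imaginary part yields \<open>mean\<close> and the real part yields
  \<open>rate\<close>.\<close>

lemma energy: "(\<Sum>j\<in>{1..n}. (\<i> * complex_of_real (lam j) - z)\<^sup>2 * (cmod (c j))\<^sup>2) = (norm w)\<^sup>2"
proof -
  have sq: "complex_of_real ((cmod z)\<^sup>2) = cnj z * z" for z
    by (metis complex_norm_square mult.commute of_real_power)
  have "complex_of_real ((norm w)\<^sup>2) = cprod y (B *v w)"
    by (simp add: cprod_adj cprod_self)
  also have "\<dots> = (\<Sum>j\<in>{1..n}. cnj (c j) * cprod (adj B *v v j) w)"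
    unfolding parseval[of y "B *v w"] by (simp only: cprod_adj[of "v j" for j])
  also have "\<dots> = (\<Sum>j\<in>{1..n}. (\<i> * complex_of_real (lam j) - z)\<^sup>2 * (cmod (c j))\<^sup>2)"
    by (intro sum.cong refl) (simp only: sq coord[symmetric] mult_ac)
  finally show ?thesis by simp
qed

lemma mean: "(\<Sum>j\<in>{1..n}. (lam j - s) * (cmod (c j))\<^sup>2) = 0"
proof -
  have "0 = Im (\<Sum>j\<in>{1..n}. (\<i> * complex_of_real (lam j) - z)\<^sup>2 * (cmod (c j))\<^sup>2)"
    unfolding energy by (simp del: of_real_power add: of_real_power[symmetric])
  also have "\<dots> = 2 * r * (\<Sum>j\<in>{1..n}. (lam j - s) * (cmod (c j))\<^sup>2)"
    unfolding shift sum_distrib_left Im_sum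
    by (intro sum.cong refl)
      (simp add: power2_eq_square[of "Complex _ _"] del: of_real_power add: of_real_power[symmetric])
  finally show ?thesis
    using r_pos by auto
qed

lemma rate: "r\<^sup>2 = (\<Sum>j\<in>{1..n}. (lam j - s)\<^sup>2 * (cmod (c j))\<^sup>2) + (norm w)\<^sup>2"
proof -
  have "(norm w)\<^sup>2 = Re (\<Sum>j\<in>{1..n}. (\<i> * complex_of_real (lam j) - z)\<^sup>2 * (cmod (c j))\<^sup>2)"
    unfolding energy by (simp del: of_real_power add: of_real_power[symmetric])
  also have "\<dots> = (\<Sum>j\<in>{1..n}. r\<^sup>2 * (cmod (c j))\<^sup>2 - (lam j - s)\<^sup>2 * (cmod (c j))\<^sup>2)"
    unfolding shift Re_sum
    by (intro sum.cong refl)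
      (simp add: power2_eq_square[of "Complex _ _"] algebra_simps power2_eq_square[of "lam _ - _"]
        power2_eq_square[of "Re _"] power2_eq_square[of "lam _"] power2_eq_square[of "Im _"]
        del: of_real_power add: of_real_power[symmetric])
  also have "\<dots> = r\<^sup>2 - (\<Sum>j\<in>{1..n}. (lam j - s)\<^sup>2 * (cmod (c j))\<^sup>2)"
    by (simp add: sum_subtractf sum_distrib_left[symmetric] sum_c[simplified])
  finally show ?thesis by simp
qed

lemma norm_w_le_r: "norm w \<le> r"
proof -
  have "(norm w)\<^sup>2 \<le> r\<^sup>2"
    unfolding rate by (simp add: sum_nonneg)
  then show ?thesis
    using r_pos power2_le_imp_le by (meson less_imp_le)
qed

text \<open>By \<open>mean\<close>, \<open>s\<close> is a convex combination of the
  \<open>lam j\<close>.\<close>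

lemma Im_bounds: "lam 1 \<le> s" "s \<le> lam n"
proof -
  have "0 = (\<Sum>j\<in>{1..n}. (lam j - lam 1) * (cmod (c j))\<^sup>2) + (lam 1 - s)"
    using mean sum_c
    by (simp add: left_diff_distrib sum_subtractf sum_distrib_left[symmetric])
  moreover have "0 \<le> (\<Sum>j\<in>{1..n}. (lam j - lam 1) * (cmod (c j))\<^sup>2)"
    by (intro sum_nonneg mult_nonneg_nonneg) (auto simp: lam_mono)
  ultimately show "lam 1 \<le> s" by linarith
  have "0 = (\<Sum>j\<in>{1..n}. (lam n - lam j) * (cmod (c j))\<^sup>2) - (lam n - s)"
    using mean sum_c
    by (simp add: left_diff_distrib sum_subtractf sum_distrib_left[symmetric])
  moreover have "0 \<le> (\<Sum>j\<in>{1..n}. (lam n - lam j) * (cmod (c j))\<^sup>2)"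
    by (intro sum_nonneg mult_nonneg_nonneg) (auto simp: lam_mono)
  ultimately show "s \<le> lam n" by linarith
qed

text \<open>By \<open>coord\<close> each coordinate of \<open>B *v w\<close> is at least r^2 times
  that of \<open>y\<close> in modulus, so r^2 is at most \<open>norm (B *v w)\<close>, hence at most
  \<open>opnorm B * r\<close>. Fourth powers arise because Parseval is stated for squares.\<close>

lemma r_le_opnorm: "r \<le> opnorm B"
proof -
  have "r ^ 4 = (\<Sum>j\<in>{1..n}. (r\<^sup>2 * cmod (c j))\<^sup>2)"
    by (simp add: power_mult_distrib sum_distrib_left[symmetric] sum_c[simplified] flip: power_mult)
  also have "\<dots> \<le> (\<Sum>j\<in>{1..n}. (cmod (cprod (v j) (B *v w)))\<^sup>2)"
  proof (intro sum_mono power_mono)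
    fix j assume j: "j \<in> {1..n}"
    have "r\<^sup>2 * cmod (c j) \<le> cmod ((\<i> * complex_of_real (lam j) - z)\<^sup>2) * cmod (c j)"
      unfolding norm_shift_sq by (intro mult_right_mono) auto
    also have "\<dots> = cmod (cprod (v j) (B *v w))"
      by (simp only: norm_mult[symmetric] coord[OF j] cprod_adj)
    finally show "r\<^sup>2 * cmod (c j) \<le> cmod (cprod (v j) (B *v w))" .
  qed simp
  also have "\<dots> = (norm (B *v w))\<^sup>2"
    by (rule parseval_norm[symmetric])
  also have "\<dots> \<le> (opnorm B * r)\<^sup>2"
    by (intro power_mono order_trans[OF norm_mult_le_opnorm] mult_left_mono norm_w_le_r
        opnorm_nonneg) simp
  finally have "r\<^sup>2 * r\<^sup>2 \<le> (opnorm B)\<^sup>2 * r\<^sup>2"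
    by (simp add: power_mult_distrib power4_eq_xxxx power2_eq_square mult_ac)
  then have "r\<^sup>2 \<le> (opnorm B)\<^sup>2"
    using r_pos by (simp add: power2_eq_square)
  then show ?thesis
    using opnorm_nonneg power2_le_imp_le by blast
qed

lemma obtain_nearest:
  obtains k where "k \<in> {1..n}" "\<And>j. j \<in> {1..n} \<Longrightarrow> \<bar>lam k - s\<bar> \<le> \<bar>lam j - s\<bar>"
proof -
  have "finite {1..n}" "{1..n} \<noteq> {}"
    using n_pos by auto
  then show ?thesis
    using that ex_min_if_finite[of "(\<lambda>j. \<bar>lam j - s\<bar>) ` {1..n}"]
    by (metis (no_types, lifting) arg_min_if_finite(1) arg_min_least)
qed

lemma norm_B_adj_v_le: "j \<in> {1..n} \<Longrightarrow> norm (adj B *v v j) \<le> opnorm B"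
  using norm_adj_mult_le[of B "v j"] by (simp add: norm_v[simplified])

lemma complement_mass:
  assumes "k \<in> {1..n}"
  shows "(norm (y - c k *s v k))\<^sup>2 = 1 - (cmod (c k))\<^sup>2"
    and "(\<Sum>j\<in>{1..n} - {k}. (cmod (c j))\<^sup>2) = 1 - (cmod (c k))\<^sup>2"
proof -
  show *: "(\<Sum>j\<in>{1..n} - {k}. (cmod (c j))\<^sup>2) = 1 - (cmod (c k))\<^sup>2"
    using assms sum_c by (subst sum_diff1) auto
  have "cprod (v j) (y - c k *s v k) = (if j = k then 0 else c j)" if "j \<in> {1..n}" for j
    using orth[OF that assms] by (simp add: cprod_diff cprod_scale)
  then have "(norm (y - c k *s v k))\<^sup>2 = (\<Sum>j\<in>{1..n}. if j = k then 0 else (cmod (c j))\<^sup>2)"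
    unfolding parseval_norm by (intro sum.cong) auto
  also have "\<dots> = (\<Sum>j\<in>{1..n} - {k}. (cmod (c j))\<^sup>2)"
    using assms by (intro sum.mono_neutral_cong_right) auto
  finally show "(norm (y - c k *s v k))\<^sup>2 = 1 - (cmod (c k))\<^sup>2"
    using * by simp
qed

end

text \<open>The scalar core of \<open>rate_gt\<close>: \<open>a\<close> is the modulus of
  \<open>c k\<close>, \<open>e\<close> the norm of the rest of \<open>y\<close>, \<open>b\<close>
  the norm of \<open>adj B *v v k\<close>, and \<open>W\<close> that of \<open>w\<close>. Either a^2
  is at least 1/2, and \<open>b\<close> is controlled by \<open>W\<close> and \<open>e\<close>; or
  e^2 is, and the first inequality alone makes \<open>r\<close> comparable to \<delta>.\<close>

lemma rate_bound_aux:
  fixes a b \<delta> e r N W :: real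
  assumes "0 < \<delta>" "0 \<le> b" "b \<le> N" "0 < r" "0 \<le> a" "a\<^sup>2 + e\<^sup>2 = 1"
    and 1: "\<delta>\<^sup>2 / 4 * e\<^sup>2 + W\<^sup>2 \<le> r\<^sup>2" and 2: "a * b \<le> W + N * e"
  shows "b / (sqrt 2 * (1 + 2 * (N\<^sup>2 / \<delta>\<^sup>2))) < r"
proof (cases "b = 0")
  case True
  with assms show ?thesis by simp
next
  case False
  define q where "q = N / \<delta>"
  have N: "N = q * \<delta>" and q: "0 < q"
    using assms False by (auto simp: q_def)
  define f where "f = \<delta> * e / 2"
  have "b\<^sup>2 < 2 * (1 + 2 * q\<^sup>2)\<^sup>2 * r\<^sup>2"
  proof (cases "1 / 2 \<le> a\<^sup>2")
    case True
    have "(a * b)\<^sup>2 \<le> (W + 2 * q * f)\<^sup>2"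
      using 2 assms by (intro power_mono) (auto simp: N f_def)
    \<comment> \<open>Cauchy-Schwarz for the pairs (1, 2 q) and (W, f); the defect is (f - 2 q
      W)^2.\<close>
    also have "\<dots> \<le> (1 + 4 * q\<^sup>2) * (W\<^sup>2 + f\<^sup>2)"
      using zero_le_power2[of "f - 2 * q * W"] by (simp add: power2_eq_square algebra_simps)
    also have "\<dots> \<le> (1 + 4 * q\<^sup>2) * r\<^sup>2"
      using 1 by (intro mult_left_mono) (auto simp: f_def power_mult_distrib power_divide)
    \<comment> \<open>Strictness comes from the term 4 q^4, positive because
      \<open>b \<noteq> 0\<close> forces \<open>N\<close> to be positive.\<close>
    also have "\<dots> < (1 + 2 * q\<^sup>2)\<^sup>2 * r\<^sup>2"
      using q assms by (intro mult_strict_right_mono) (auto simp: power2_eq_square algebra_simps)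
    finally have "a\<^sup>2 * b\<^sup>2 < (1 + 2 * q\<^sup>2)\<^sup>2 * r\<^sup>2"
      by (simp add: power_mult_distrib)
    moreover have "1 / 2 * b\<^sup>2 \<le> a\<^sup>2 * b\<^sup>2"
      using True by (intro mult_right_mono) auto
    ultimately show ?thesis by linarith
  next
    case False
    then have e: "1 / 2 \<le> e\<^sup>2"
      using assms by linarith
    have "\<delta>\<^sup>2 / 8 \<le> \<delta>\<^sup>2 / 4 * e\<^sup>2"
      using mult_left_mono[OF e, of "\<delta>\<^sup>2 / 4"] by simp
    then have r: "\<delta>\<^sup>2 / 8 \<le> r\<^sup>2"
      using 1 zero_le_power2[of W] by linarith
    have "b\<^sup>2 \<le> q\<^sup>2 * \<delta>\<^sup>2"
      using assms by (auto simp: power_mult_distrib[symmetric] N intro: power_mono)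
    also have "\<dots> < 2 * (8 * q\<^sup>2) * (\<delta>\<^sup>2 / 8)"
      using q assms by simp
    also have "\<dots> \<le> 2 * (1 + 2 * q\<^sup>2)\<^sup>2 * (\<delta>\<^sup>2 / 8)"
      using zero_le_power2[of "1 - 2 * q\<^sup>2"]
      by (intro mult_right_mono mult_left_mono) (auto simp: power2_eq_square algebra_simps)
    \<comment> \<open>The arithmetic-geometric mean inequality in the form 8 q^2 \<le> (1 + 2
      q^2)^2.\<close>
    also have "\<dots> \<le> 2 * (1 + 2 * q\<^sup>2)\<^sup>2 * r\<^sup>2"
      using r by (intro mult_left_mono) auto
    finally show ?thesis .
  qed
  also have "\<dots> = (sqrt 2 * (1 + 2 * q\<^sup>2) * r)\<^sup>2"
    by (simp add: power_mult_distrib)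
  finally have "b < sqrt 2 * (1 + 2 * q\<^sup>2) * r"
    using assms by (elim power_less_imp_less_base) auto
  moreover have "0 < sqrt 2 * (1 + 2 * q\<^sup>2)"
    by (simp add: add_pos_nonneg)
  ultimately show ?thesis
    by (simp add: q_def power_divide pos_divide_less_eq mult_ac)
qed

context pencil
begin

lemma far_from_nearest:
  assumes "k \<in> {1..n}" "\<And>j. j \<in> {1..n} \<Longrightarrow> \<bar>lam k - s\<bar> \<le> \<bar>lam j - s\<bar>"
    and "j \<in> {1..n}" "j \<noteq> k"
  shows "eig_gap n lam k \<le> 2 * \<bar>lam j - s\<bar>" "eig_gap n lam k - \<bar>lam k - s\<bar> \<le> \<bar>lam j - s\<bar>"
  using eig_gap_le[OF assms(1,3,4), of lam] assms(2)[OF assms(3)] abs_triangle_ineq4[of "lam j - s" "lam k - s"]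
  by simp_all

text \<open>All \<open>lam j\<close> other than the nearest one are at least \<delta>/2 away from
  \<open>s\<close>, so by \<open>rate\<close> the part \<open>y'\<close> of \<open>y\<close>
  orthogonal to \<open>v k\<close> adds at least \<delta>^2/4 times its squared norm to r^2. The
  second input of \<open>rate_bound_aux\<close> is the triangle inequality for the splitting of
  \<open>w\<close> along \<open>v k\<close> and \<open>y'\<close>.\<close>

lemma rate_gt:
  assumes "2 \<le> n" "inj_on lam {1..n}"
  obtains k where "k \<in> {1..n}"
    "norm (adj B *v v k) / (sqrt 2 * (1 + 2 * ((opnorm B)\<^sup>2 / (eig_gap n lam k)\<^sup>2))) < r"
proof -
  obtain k where k: "k \<in> {1..n}" "\<And>j. j \<in> {1..n} \<Longrightarrow> \<bar>lam k - s\<bar> \<le> \<bar>lam j - s\<bar>"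
    using obtain_nearest by blast
  define \<delta> where "\<delta> = eig_gap n lam k"
  have \<delta>: "0 < \<delta>"
    unfolding \<delta>_def by (rule eig_gap_pos) (use assms k in auto)
  define y' where "y' = y - c k *s v k"
  have y': "(norm y')\<^sup>2 = 1 - (cmod (c k))\<^sup>2"
    unfolding y'_def by (rule complement_mass(1)) fact
  have "\<delta>\<^sup>2 / 4 * (norm y')\<^sup>2 = (\<Sum>j\<in>{1..n} - {k}. \<delta>\<^sup>2 / 4 * (cmod (c j))\<^sup>2)"
    unfolding y' complement_mass(2)[OF k(1), symmetric] by (rule sum_distrib_left)
  also have "\<dots> \<le> (\<Sum>j\<in>{1..n} - {k}. (lam j - s)\<^sup>2 * (cmod (c j))\<^sup>2)"
  proof (intro sum_mono mult_right_mono)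
    fix j assume "j \<in> {1..n} - {k}"
    then have "\<delta> \<le> 2 * \<bar>lam j - s\<bar>"
      using far_from_nearest(1)[OF k] by (simp add: \<delta>_def)
    then have "\<delta>\<^sup>2 \<le> (2 * \<bar>lam j - s\<bar>)\<^sup>2"
      using \<delta> by (intro power_mono) auto
    then show "\<delta>\<^sup>2 / 4 \<le> (lam j - s)\<^sup>2"
      by (simp add: power_mult_distrib)
  qed simp
  also have "\<dots> \<le> (\<Sum>j\<in>{1..n}. (lam j - s)\<^sup>2 * (cmod (c j))\<^sup>2)"
    by (intro sum_mono2) auto
  finally have 1: "\<delta>\<^sup>2 / 4 * (norm y')\<^sup>2 + (norm w)\<^sup>2 \<le> r\<^sup>2"
    unfolding rate by simp
  have "c k *s (adj B *v v k) = w - adj B *v y'"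
    by (simp add: y'_def matrix_vector_mult_diff_distrib matrix_vector_scale)
  then have "norm (c k *s (adj B *v v k)) \<le> norm w + norm (adj B *v y')"
    by (simp add: norm_triangle_ineq4)
  then have 2: "cmod (c k) * norm (adj B *v v k) \<le> norm w + opnorm B * norm y'"
    using norm_adj_mult_le[of B y'] by (simp add: norm_vec_scale)
  show ?thesis
    by (rule that[OF k(1)], fold \<delta>_def, rule rate_bound_aux[OF \<delta> _ _ _ _ _ 1 2])
      (use norm_B_adj_v_le[OF k(1)] r_pos y' in auto)
qed

end

section \<open>The case of a single input\<close>

lemma norm_vec_single:
  assumes "UNIV = {e :: 'm}"
  shows "norm (x :: complex^'m) = cmod (x $ e)"
  by (simp add: norm_vec_def L2_set_def assms)

lemma cprod_single:
  assumes "UNIV = {e :: 'm}"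
  shows "cprod x (y :: complex^'m) = cnj (x $ e) * y $ e"
  by (simp add: cprod_def assms)

context pencil
begin

text \<open>Up to conjugation, \<open>adj B *v v j\<close> is the coordinate along
  \<open>v j\<close> of the only column of \<open>B\<close>, so Parseval applies to that
  column.\<close>

lemma sum_norm_adj_v:
  assumes e: "UNIV = {e :: 'm}"
  shows "(\<Sum>j\<in>{1..n}. (norm (adj B *v v j))\<^sup>2) \<le> (opnorm B)\<^sup>2"
proof -
  have "(\<Sum>j\<in>{1..n}. (norm (adj B *v v j))\<^sup>2) = (norm (B *v axis e 1))\<^sup>2"
    unfolding parseval_norm
    by (intro sum.cong refl) (simp add: cprod_adj cprod_single[OF e] norm_vec_single[OF e])
  also have "\<dots> \<le> (opnorm B)\<^sup>2"
    using norm_mult_le_opnorm[of B "axis e 1"] by (intro power_mono) auto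
  finally show ?thesis .
qed

text \<open>As \<open>w\<close> is a scalar, \<open>coord\<close> fixes the moduli of all
  \<open>c j\<close> up to a common factor, and \<open>energy\<close> turns into a secular equation,
  the sum of the \<open>P j\<close> being 1. Isolating its term nearest to \<open>s\<close> bounds
  the square of \<open>b k\<close>, whence the square root in the estimate.\<close>

lemma rate_gt_single:
  assumes "2 \<le> n" "inj_on lam {1..n}" and e: "UNIV = {e :: 'm}"
  obtains k where "k \<in> {1..n}"
    "norm (adj B *v v k) / (sqrt 2 * sqrt (1 + 2 * ((opnorm B)\<^sup>2 / (eig_gap n lam k)\<^sup>2))) < r"
proof -
  obtain k where k: "k \<in> {1..n}" "\<And>j. j \<in> {1..n} \<Longrightarrow> \<bar>lam k - s\<bar> \<le> \<bar>lam j - s\<bar>"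
    using obtain_nearest by blast
  define \<delta> where "\<delta> = eig_gap n lam k"
  have \<delta>: "0 < \<delta>"
    unfolding \<delta>_def by (rule eig_gap_pos) (use assms k in auto)
  define b where "b j = norm (adj B *v v j)" for j
  define N where "N = opnorm B"
  define a where "a j = lam j - s" for j
  have sq_pos: "0 < (a j)\<^sup>2 + r\<^sup>2" for j
    using r_pos by (intro add_nonneg_pos) auto
  have c: "cmod (c j) * ((a j)\<^sup>2 + r\<^sup>2) = b j * norm w" if "j \<in> {1..n}" for j
  proof -
    have "cmod (c j) * ((a j)\<^sup>2 + r\<^sup>2) = cmod ((\<i> * complex_of_real (lam j) - z)\<^sup>2 * c j)"
      unfolding norm_mult norm_shift_sq by (simp add: a_def)
    also have "\<dots> = b j * norm w"
      unfolding coord[OF that] by (simp add: cprod_single[OF e] norm_vec_single[OF e] b_def norm_mult)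
    finally show ?thesis .
  qed
  have "norm w \<noteq> 0"
  proof
    assume "norm w = 0"
    then have "c j = 0" if "j \<in> {1..n}" for j
      using c[OF that] sq_pos[of j] Re_z by simp
    then show False
      using sum_c by simp
  qed
  \<comment> \<open>\<open>P j\<close> is the square of \<open>b j\<close> over the conjugate of
    (\<i> lam j - z)^2, written with a real denominator.\<close>
  define P where "P j = (\<i> * complex_of_real (lam j) - z)\<^sup>2 * complex_of_real ((b j)\<^sup>2 / ((a j)\<^sup>2 + r\<^sup>2)\<^sup>2)" for j
  have "(\<Sum>j\<in>{1..n}. P j) * (norm w)\<^sup>2
      = (\<Sum>j\<in>{1..n}. (\<i> * complex_of_real (lam j) - z)\<^sup>2 * (cmod (c j))\<^sup>2)"
    unfolding sum_distrib_right
  proof (intro sum.cong refl)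
    fix j assume j: "j \<in> {1..n}"
    have "cmod (c j) = b j * norm w / ((a j)\<^sup>2 + r\<^sup>2)"
      using c[OF j] sq_pos[of j] Re_z by (simp add: eq_divide_eq)
    then have "(cmod (c j))\<^sup>2 = (b j)\<^sup>2 / ((a j)\<^sup>2 + r\<^sup>2)\<^sup>2 * (norm w)\<^sup>2"
      by (simp add: power_mult_distrib power_divide)
    then show "P j * (norm w)\<^sup>2 = (\<i> * complex_of_real (lam j) - z)\<^sup>2 * (cmod (c j))\<^sup>2"
      unfolding P_def by (metis mult.assoc of_real_mult of_real_power)
  qed
  then have sum_P: "(\<Sum>j\<in>{1..n}. P j) = 1"
    unfolding energy using \<open>norm w \<noteq> 0\<close> by simp
  have norm_P: "cmod (P j) = (b j)\<^sup>2 / ((a j)\<^sup>2 + r\<^sup>2)" for j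
  proof -
    have "cmod (P j) = ((a j)\<^sup>2 + r\<^sup>2) * ((b j)\<^sup>2 / ((a j)\<^sup>2 + r\<^sup>2)\<^sup>2)"
      unfolding P_def norm_mult norm_shift_sq norm_of_real by (simp add: a_def)
    then show ?thesis
      using sq_pos[of j] by (simp add: power2_eq_square[of "_ + _"])
  qed
  have Re_P: "Re (P j) = (r\<^sup>2 - (a j)\<^sup>2) * ((b j)\<^sup>2 / ((a j)\<^sup>2 + r\<^sup>2)\<^sup>2)" for j
    unfolding P_def shift by (simp add: power2_eq_square[of "Complex _ _"] a_def power2_eq_square[of "Re _"]
      power2_eq_square[of "lam _ - _"] del: of_real_power of_real_divide of_real_mult)
  \<comment> \<open>If even the nearest \<open>lam k\<close> were at distance at least
    \<open>r\<close>, every \<open>P j\<close> would have nonpositive real part, although they sum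
    to 1.\<close>
  have ak: "\<bar>a k\<bar> < r"
  proof (rule ccontr)
    assume "\<not> \<bar>a k\<bar> < r"
    then have "r \<le> \<bar>a j\<bar>" if "j \<in> {1..n}" for j
      using k(2)[OF that] by (simp add: a_def)
    then have "r\<^sup>2 \<le> (a j)\<^sup>2" if "j \<in> {1..n}" for j
      using power_mono[of r "\<bar>a j\<bar>" 2] that r_pos by simp
    then have "Re (P j) \<le> 0" if "j \<in> {1..n}" for j
      unfolding Re_P using that by (intro mult_nonpos_nonneg) auto
    then have "(\<Sum>j\<in>{1..n}. Re (P j)) \<le> 0"
      by (rule sum_nonpos)
    then show False
      using arg_cong[OF sum_P, of Re] by simp
  qed
  have ak_sq: "(a k)\<^sup>2 < r\<^sup>2"
    using power_strict_mono[OF ak, of 2] by simp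
  have bk_N: "(b k)\<^sup>2 \<le> N\<^sup>2"
    using norm_B_adj_v_le[OF k(1)] by (simp add: b_def N_def power_mono)
  have "(b k)\<^sup>2 < 2 * r\<^sup>2 * (1 + 2 * (N\<^sup>2 / \<delta>\<^sup>2))"
  \<comment> \<open>For a small gap the crude bound of \<open>b k\<close> by \<open>N\<close>
    suffices; for a large one the terms \<open>P j\<close> with \<open>j \<noteq> k\<close> are
    small.\<close>
  proof (cases "\<delta> \<le> 2 * r")
    case True
    then have "\<delta>\<^sup>2 \<le> (2 * r)\<^sup>2"
      using \<delta> by (intro power_mono) auto
    then have "N\<^sup>2 * \<delta>\<^sup>2 \<le> N\<^sup>2 * (2 * r)\<^sup>2"
      by (rule mult_left_mono) simp
    then have "N\<^sup>2 \<le> 4 * r\<^sup>2 * (N\<^sup>2 / \<delta>\<^sup>2)"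
      using \<delta> by (simp add: pos_le_divide_eq power_mult_distrib mult_ac)
    moreover have "0 < r\<^sup>2"
      using r_pos by simp
    moreover have "2 * r\<^sup>2 * (1 + 2 * (N\<^sup>2 / \<delta>\<^sup>2)) = 2 * r\<^sup>2 + 4 * r\<^sup>2 * (N\<^sup>2 / \<delta>\<^sup>2)"
      by (simp add: distrib_left)
    ultimately show ?thesis
      using bk_N by linarith
  next
    case False
    have P_le: "cmod (P j) \<le> (b j)\<^sup>2 * (2 / \<delta>\<^sup>2)" if "j \<in> {1..n} - {k}" for j
    proof -
      have "\<delta> - r \<le> \<bar>a j\<bar>"
        using far_from_nearest(2)[OF k, of j] that ak by (simp add: \<delta>_def a_def)
      then have "(\<delta> - r)\<^sup>2 \<le> (a j)\<^sup>2"
        using False r_pos power_mono[of "\<delta> - r" "\<bar>a j\<bar>" 2] by simp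
      \<comment> \<open>The right side is smallest at r = \<delta>/2.\<close>
      moreover have "\<delta>\<^sup>2 / 2 \<le> (\<delta> - r)\<^sup>2 + r\<^sup>2"
        using zero_le_power2[of "\<delta> - 2 * r"] by (simp add: power2_eq_square algebra_simps)
      ultimately have "\<delta>\<^sup>2 / 2 \<le> (a j)\<^sup>2 + r\<^sup>2"
        by linarith
      then have "(b j)\<^sup>2 / ((a j)\<^sup>2 + r\<^sup>2) \<le> (b j)\<^sup>2 / (\<delta>\<^sup>2 / 2)"
        using \<delta> sq_pos[of j] by (intro divide_left_mono mult_pos_pos) auto
      then show ?thesis
        by (simp add: norm_P)
    qed
    have "P k = 1 - (\<Sum>j\<in>{1..n} - {k}. P j)"
      using k(1) sum_P by (subst sum_diff1) auto
    then have "cmod (P k) \<le> 1 + cmod (\<Sum>j\<in>{1..n} - {k}. P j)"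
      by (metis norm_one norm_triangle_ineq4)
    also have "\<dots> \<le> 1 + (\<Sum>j\<in>{1..n} - {k}. (b j)\<^sup>2 * (2 / \<delta>\<^sup>2))"
      using P_le by (intro add_left_mono order_trans[OF norm_sum] sum_mono) auto
    also have "\<dots> = 1 + (\<Sum>j\<in>{1..n} - {k}. (b j)\<^sup>2) * (2 / \<delta>\<^sup>2)"
      by (simp only: sum_distrib_right)
    also have "\<dots> \<le> 1 + N\<^sup>2 * (2 / \<delta>\<^sup>2)"
    proof (intro add_left_mono mult_right_mono)
      show "(\<Sum>j\<in>{1..n} - {k}. (b j)\<^sup>2) \<le> N\<^sup>2"
        using sum_norm_adj_v[OF e] sum_mono2[of "{1..n}" "{1..n} - {k}" "\<lambda>j. (b j)\<^sup>2"]
        by (simp add: b_def N_def)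
    qed simp
    finally have "(b k)\<^sup>2 \<le> (1 + N\<^sup>2 * (2 / \<delta>\<^sup>2)) * ((a k)\<^sup>2 + r\<^sup>2)"
      unfolding norm_P using sq_pos by (simp add: pos_divide_le_eq)
    \<comment> \<open>Replacing a_k^2 + r^2 by 2 r^2 is the origin of the factor
      \<open>sqrt 2\<close> in the estimate.\<close>
    also have "\<dots> < (1 + N\<^sup>2 * (2 / \<delta>\<^sup>2)) * (2 * r\<^sup>2)"
      using ak_sq by (intro mult_strict_left_mono) (auto intro: add_pos_nonneg)
    finally show ?thesis
      by (simp add: mult_ac)
  qed
  also have "\<dots> = (r * (sqrt 2 * sqrt (1 + 2 * (N\<^sup>2 / \<delta>\<^sup>2))))\<^sup>2"
    by (simp add: power_mult_distrib)
  finally have "(b k)\<^sup>2 < (r * (sqrt 2 * sqrt (1 + 2 * (N\<^sup>2 / \<delta>\<^sup>2))))\<^sup>2" .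
  then have "b k < r * (sqrt 2 * sqrt (1 + 2 * (N\<^sup>2 / \<delta>\<^sup>2)))"
    by (rule power_less_imp_less_base) (intro mult_nonneg_nonneg less_imp_le[OF r_pos]; simp)
  moreover have "0 < sqrt 2 * sqrt (1 + 2 * (N\<^sup>2 / \<delta>\<^sup>2))"
    by (simp add: add_pos_nonneg)
  ultimately show ?thesis
    using that[OF k(1)] by (simp add: b_def N_def \<delta>_def pos_divide_less_eq)
qed

text \<open>Split \<open>y\<close> into \<open>y1\<close> in the range of \<open>B\<close> and
  \<open>y2\<close> in the kernel of \<open>adj B\<close>. Testing the pencil with \<open>y2\<close>
  removes the right side and bounds \<open>norm y2\<close> by 3/4 once \<open>r\<close> is at least
  \<open>sqrt 3 * \<Delta>\<close>; then \<sigma> times \<open>norm y1\<close> is at most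
  \<open>norm w\<close>, hence at most \<open>r\<close>.\<close>

lemma rate_dichotomy:
  assumes \<sigma>: "0 < \<sigma>" "\<And>u. \<sigma> * norm u \<le> norm (B *v u)"
    and r: "sqrt 3 * (lam n - lam 1) \<le> r"
  shows "sqrt 6 / 4 * \<sigma> \<le> r"
proof -
  define \<Delta> where "\<Delta> = lam n - lam 1"
  have \<Delta>: "0 \<le> \<Delta>"
    using lam_mono[of 1 n] n_pos by (simp add: \<Delta>_def)
  define K where "K x = A *v x - (\<i> * complex_of_real s) *s x" for x
  have K_coord: "cmod (cprod (v j) (K x)) = \<bar>lam j - s\<bar> * cmod (cprod (v j) x)" if "j \<in> {1..n}" for j x
  proof -
    have "cprod (v j) (K x) = \<i> * complex_of_real (lam j - s) * cprod (v j) x"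
      using that by (simp add: K_def cprod_diff cprod_scale coord_A algebra_simps)
    then show ?thesis
      by (simp only: norm_mult norm_of_real) simp
  qed
  have K_skew: "cprod x (K x') = - cprod (K x) x'" for x x'
    by (simp add: K_def cprod_diff cprod_scale cprod_adj[of x A] skew matrix_vector_minus cprod_minus)
  have K_le: "norm (K x) \<le> \<Delta> * norm x" for x
  proof (rule power2_le_imp_le)
    have "(norm (K x))\<^sup>2 = (\<Sum>j\<in>{1..n}. (\<bar>lam j - s\<bar> * cmod (cprod (v j) x))\<^sup>2)"
      unfolding parseval_norm using K_coord by (intro sum.cong) auto
    also have "\<dots> \<le> (\<Sum>j\<in>{1..n}. (\<Delta> * cmod (cprod (v j) x))\<^sup>2)"
    proof (intro sum_mono power_mono mult_right_mono)
      fix j assume "j \<in> {1..n}"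
      then have "lam 1 \<le> lam j" "lam j \<le> lam n"
        by (auto intro: lam_mono)
      then show "\<bar>lam j - s\<bar> \<le> \<Delta>"
        using Im_bounds by (simp add: \<Delta>_def abs_le_iff)
    qed auto
    also have "\<dots> = (\<Delta> * norm x)\<^sup>2"
      by (simp only: power_mult_distrib sum_distrib_left[symmetric] parseval_norm[symmetric])
    finally show "(norm (K x))\<^sup>2 \<le> (\<Delta> * norm x)\<^sup>2" .
  qed (use \<Delta> in auto)
  \<comment> \<open>\<open>K y\<close> has the size of a standard deviation, so Popoviciu's inequality halves the bound.\<close>
  have Ky: "norm (K y) \<le> \<Delta> / 2"
  proof (rule power2_le_imp_le)
    define h where "h = (lam 1 + lam n) / 2"
    have "(norm (K y))\<^sup>2 = (\<Sum>j\<in>{1..n}. (\<bar>lam j - s\<bar> * cmod (c j))\<^sup>2)"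
      unfolding parseval_norm using K_coord by (intro sum.cong) auto
    also have "\<dots> = (\<Sum>j\<in>{1..n}. (lam j - h)\<^sup>2 * (cmod (c j))\<^sup>2 - (2 * (s - h)) * ((lam j - s) * (cmod (c j))\<^sup>2)
        - (s - h)\<^sup>2 * (cmod (c j))\<^sup>2)"
      by (intro sum.cong refl) (simp add: power_mult_distrib, simp add: power2_eq_square algebra_simps)
    also have "\<dots> = (\<Sum>j\<in>{1..n}. (lam j - h)\<^sup>2 * (cmod (c j))\<^sup>2) - (s - h)\<^sup>2"
      unfolding sum_subtractf sum_distrib_left[symmetric] mean sum_c by simp
    also have "\<dots> \<le> (\<Sum>j\<in>{1..n}. (\<Delta> / 2)\<^sup>2 * (cmod (c j))\<^sup>2)"
    proof -
      have "(\<Sum>j\<in>{1..n}. (lam j - h)\<^sup>2 * (cmod (c j))\<^sup>2) \<le> (\<Sum>j\<in>{1..n}. (\<Delta> / 2)\<^sup>2 * (cmod (c j))\<^sup>2)"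
      proof (intro sum_mono mult_right_mono)
        fix j assume "j \<in> {1..n}"
        then have "lam 1 \<le> lam j" "lam j \<le> lam n"
          by (auto intro: lam_mono)
        then have "\<bar>lam j - h\<bar> \<le> \<bar>\<Delta> / 2\<bar>"
          using \<Delta> by (simp add: \<Delta>_def h_def abs_le_iff field_simps)
        then show "(lam j - h)\<^sup>2 \<le> (\<Delta> / 2)\<^sup>2"
          by (simp only: abs_le_square_iff)
      qed auto
      then show ?thesis
        using zero_le_power2[of "s - h"] by linarith
    qed
    also have "\<dots> = (\<Delta> / 2)\<^sup>2"
      unfolding sum_distrib_left[symmetric] sum_c by simp
    finally show "(norm (K y))\<^sup>2 \<le> (\<Delta> / 2)\<^sup>2" .
  qed (use \<Delta> in auto)
  \<comment> \<open>The normal equations: \<open>B *v u\<close> will be the orthogonal projection of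
    \<open>y\<close> to the range of \<open>B\<close>.\<close>
  have "\<exists>u. adj B *v (B *v u) = w"
  proof -
    have "u = 0" if "adj B *v (B *v u) = 0" for u
    proof -
      have "cprod (B *v u) (B *v u) = 0"
        by (metis cprod_adj_right cprod_zero(1) that)
      then have "norm (B *v u) = 0"
        by (simp add: cprod_self)
      then have "norm u \<le> 0"
        using \<sigma>(2)[of u] \<sigma>(1) by (simp add: mult_le_0_iff)
      then show ?thesis by simp
    qed
    then have "\<exists>M. M ** (adj B ** B) = mat 1"
      unfolding matrix_left_invertible_ker by (simp add: matrix_vector_mul_assoc)
    then obtain M where "(adj B ** B) ** M = mat 1"
      using matrix_left_right_inverse by blast
    then have "adj B *v (B *v (M *v w)) = w"
      by (simp add: matrix_vector_mul_assoc matrix_mul_assoc)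
    then show ?thesis by blast
  qed
  then obtain u where u: "adj B *v (B *v u) = w" by blast
  define y1 where "y1 = B *v u"
  define y2 where "y2 = y - y1"
  have ker: "adj B *v y2 = 0"
    by (simp add: y2_def y1_def matrix_vector_mult_diff_distrib u)
  have orth12: "cprod y2 y1 = 0"
    by (simp add: y1_def cprod_adj ker)
  then have y2_y: "cprod y2 y = (norm y2)\<^sup>2"
    using cprod_self[of y2] by (simp add: y2_def cprod_diff)
  have pythagoras: "(norm y1)\<^sup>2 + (norm y2)\<^sup>2 = 1"
  proof -
    have "cprod y y = cprod (y1 + y2) (y1 + y2)"
      by (simp add: y2_def)
    also have "\<dots> = cprod y1 y1 + cprod y2 y2"
      using orth12 cnj_cprod[of y2 y1] by (simp add: cprod_add)
    finally have "complex_of_real ((norm y1)\<^sup>2 + (norm y2)\<^sup>2) = complex_of_real 1"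
      by (simp add: cprod_self norm_y)
    then show ?thesis
      using of_real_eq_iff by blast
  qed
  have w_ge: "\<sigma> * norm y1 \<le> norm w"
  proof (cases "norm y1 = 0")
    case False
    have "(norm y1)\<^sup>2 = cmod (cprod u w)"
      unfolding u[symmetric] y1_def cprod_adj_right by (simp add: cprod_self norm_power)
    also have "\<dots> \<le> norm u * norm w"
      by (rule norm_cprod_le)
    finally have "\<sigma> * (norm y1)\<^sup>2 \<le> \<sigma> * norm u * norm w"
      using \<sigma>(1) by (simp add: mult.assoc)
    also have "\<dots> \<le> norm y1 * norm w"
      using \<sigma>(2)[of u] by (intro mult_right_mono) (auto simp: y1_def)
    finally show ?thesis
      using False by (simp add: power2_eq_square)
  qed simp
  have y2_le: "r\<^sup>2 * norm y2 \<le> \<Delta> * (\<Delta> / 2) + 2 * r * (\<Delta> / 2)"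
  proof (cases "norm y2 = 0")
    case True
    then show ?thesis
      using mult_nonneg_nonneg[OF less_imp_le[OF r_pos] \<Delta>] zero_le_square[of \<Delta>]
      unfolding True by linarith
  next
    case False
    \<comment> \<open>Since \<open>A - z\<close> is \<open>K + r\<close>, the pencil is the expanded
      square of \<open>K + r\<close>.\<close>
    have KK: "A *v (A *v y) - (2 * z) *s (A *v y) + z\<^sup>2 *s y
        = K (K y) + (complex_of_real (2 * r)) *s K y + (complex_of_real (r\<^sup>2)) *s y"
    proof -
      have z: "z = \<i> * complex_of_real s - complex_of_real r"
        by (simp add: complex_eq_iff)
      show ?thesis
        unfolding K_def matrix_vector_mult_diff_distrib matrix_vector_scale
        by (subst (1 2) z) (simp add: vec_eq_iff algebra_simps power2_eq_square)
    qed
    have "0 = cprod y2 (B *v w)"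
      by (simp add: cprod_adj ker)
    \<comment> \<open>Only one \<open>K\<close> is moved to \<open>y2\<close>, so that every product
      keeps a factor \<open>K y\<close> with its halved bound \<open>Ky\<close>.\<close>
    also have "\<dots> = - cprod (K y2) (K y) + 2 * r * cprod y2 (K y) + r\<^sup>2 * (norm y2)\<^sup>2"
      unfolding pencil[symmetric] KK by (simp add: cprod_add cprod_diff cprod_scale K_skew[of y2 "K y"] y2_y)
    finally have "complex_of_real (r\<^sup>2 * (norm y2)\<^sup>2)
        = cprod (K y2) (K y) - complex_of_real (2 * r) * cprod y2 (K y)"
      by (simp add: algebra_simps)
    then have "cmod (complex_of_real (r\<^sup>2 * (norm y2)\<^sup>2))
        \<le> cmod (cprod (K y2) (K y)) + cmod (complex_of_real (2 * r) * cprod y2 (K y))"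
      by (simp only: norm_triangle_ineq4)
    then have "r\<^sup>2 * (norm y2)\<^sup>2 \<le> cmod (cprod (K y2) (K y)) + 2 * r * cmod (cprod y2 (K y))"
      unfolding norm_of_real norm_mult[of "complex_of_real _"] using r_pos by simp
    also have "\<dots> \<le> (\<Delta> * norm y2) * (\<Delta> / 2) + 2 * r * (norm y2 * (\<Delta> / 2))"
      using r_pos \<Delta> by (intro add_mono mult_left_mono order_trans[OF norm_cprod_le] mult_mono K_le Ky) auto
    finally have "norm y2 * (r\<^sup>2 * norm y2) \<le> norm y2 * (\<Delta> * (\<Delta> / 2) + 2 * r * (\<Delta> / 2))"
      by (simp add: power2_eq_square algebra_simps)
    then show ?thesis
      using False by simp
  qed
  define q where "q = \<Delta> / r"
  have q: "\<Delta> = q * r" "0 \<le> q" "sqrt 3 * q \<le> 1"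
    unfolding q_def using Re_z divide_nonneg_pos[OF \<Delta> r_pos] r[folded \<Delta>_def]
    by (simp, simp, simp only: times_divide_eq_right pos_divide_le_eq[OF r_pos] mult_1)
  have "norm y2 \<le> q\<^sup>2 / 2 + q"
  proof -
    have "r\<^sup>2 * norm y2 \<le> r\<^sup>2 * (q\<^sup>2 / 2 + q)"
      using y2_le unfolding q(1) by (simp add: power2_eq_square algebra_simps)
    then show ?thesis
      using r_pos by simp
  qed
  also have "\<dots> \<le> 3 / 4"
  proof -
    have "(sqrt 3 * q)\<^sup>2 \<le> 1"
      using q by (intro power_le_one) auto
    then have "q\<^sup>2 \<le> 1 / 3"
      by (simp add: power_mult_distrib)
    \<comment> \<open>7/12 is just above 1 / sqrt 3 and equals 3/4 - 1/6, which is what the sum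
      leaves.\<close>
    moreover have "q \<le> 7 / 12"
    proof (rule power2_le_imp_le)
      show "q\<^sup>2 \<le> (7 / 12)\<^sup>2"
        using \<open>q\<^sup>2 \<le> 1 / 3\<close> by (simp add: power2_eq_square)
    qed simp
    ultimately show ?thesis by linarith
  qed
  finally have "(norm y2)\<^sup>2 \<le> (3 / 4)\<^sup>2"
    by (intro power_mono) auto
  \<comment> \<open>Pythagoras leaves 7/16; the smaller 3/8 is the square of
    \<open>sqrt 6 / 4\<close>.\<close>
  then have "3 / 8 \<le> (norm y1)\<^sup>2"
    using pythagoras by (simp add: power2_eq_square)
  then have "(sqrt 6 / 4 * \<sigma>)\<^sup>2 \<le> (\<sigma> * norm y1)\<^sup>2"
    using mult_left_mono[of "3 / 8" "(norm y1)\<^sup>2" "\<sigma>\<^sup>2"]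
    by (simp add: power_mult_distrib power_divide mult.commute)
  then have "sqrt 6 / 4 * \<sigma> \<le> \<sigma> * norm y1"
    using \<sigma>(1) by (elim power2_le_imp_le) auto
  then show ?thesis
    using w_ge norm_w_le_r by linarith
qed

end

subsection \<open>Roots of complex polynomials\<close>

text \<open>Reads off degree and leading coefficient of a determinant from its growth. Dividing by
  the power of the true degree gives a nonzero limit, and a wrong exponent would force one of the
  two limits to be 0.\<close>

lemma degree_eqI_at_infinity:
  fixes p :: "complex poly"
  assumes lim: "((\<lambda>x. poly p x / x ^ d) \<longlongrightarrow> 1) at_infinity"
  shows "degree p = d" "lead_coeff p = 1"
proof -
  have "p \<noteq> 0"
  proof
    assume "p = 0"
    then have "((\<lambda>x :: complex. 0) \<longlongrightarrow> (1 :: complex)) at_infinity"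
      using lim by simp
    then show False
      using tendsto_unique[OF trivial_limit_at_infinity tendsto_const] by fastforce
  qed
  define e where "e = degree p"
  have lim': "((\<lambda>x. poly p x / x ^ e) \<longlongrightarrow> lead_coeff p) at_infinity"
    unfolding e_def by (rule poly_divide_tendsto_aux)
  \<comment> \<open>This holds at \<open>y = 0\<close> too, where both sides are 0 by the convention
    for division.\<close>
  have shift: "x / y ^ a = x / y ^ b * inverse y ^ (a - b)" if "b < a" for x y :: complex and a b
  proof (cases "y = 0")
    case False
    have "y ^ a = y ^ b * y ^ (a - b)"
      using that by (simp flip: power_add)
    then show ?thesis
      using False by (simp add: field_simps)
  next
    case True
    have "a \<noteq> 0" "a - b \<noteq> 0"
      using that by auto
    then show ?thesis
      using True by (simp only: inverse_zero power_0_left) simp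
  qed
  have "e = d"
  proof (rule ccontr)
    assume "e \<noteq> d"
    then consider "d < e" | "e < d" by linarith
    then show False
    proof cases
      case 1
      have "((\<lambda>x. poly p x / x ^ d * inverse x ^ (e - d)) \<longlongrightarrow> 1 * 0) at_infinity"
        using 1 by (intro tendsto_mult lim tendsto_null_power tendsto_inverse_0) auto
      then have "lead_coeff p = 0"
        unfolding shift[OF 1, symmetric]
        using lim' tendsto_unique[OF trivial_limit_at_infinity] by fastforce
      then show False
        using \<open>p \<noteq> 0\<close> by simp
    next
      case 2
      have "((\<lambda>x. poly p x / x ^ e * inverse x ^ (d - e)) \<longlongrightarrow> lead_coeff p * 0) at_infinity"
        using 2 by (intro tendsto_mult lim' tendsto_null_power tendsto_inverse_0) auto
      then have "(1 :: complex) = 0"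
        unfolding shift[OF 2, symmetric]
        using lim tendsto_unique[OF trivial_limit_at_infinity] by fastforce
      then show False by simp
    qed
  qed
  then show "degree p = d" "lead_coeff p = 1"
    using lim lim' tendsto_unique[OF trivial_limit_at_infinity] by (auto simp: e_def)
qed

lemma proots_prod_linear:
  assumes "finite I"
  shows "proots (\<Prod>i\<in>I. [:- f i, 1:]) = image_mset f (mset_set I)"
  using assms by (simp add: proots_prod) (induction I rule: finite_induct, auto)

text \<open>Indexing the roots by a finite type makes them a point of a Euclidean space, ready for a
  compactness argument.\<close>

lemma monic_factorization:
  fixes p :: "complex poly"
  assumes "degree p = CARD('k::finite)" "lead_coeff p = 1"
  obtains f :: "complex^'k" where "p = (\<Prod>i\<in>UNIV. [:- (f $ i), 1:])"
proof -
  obtain xs where xs: "mset xs = proots p"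
    using ex_mset by blast
  have len: "length xs = CARD('k)"
    using assms size_proots_complex[of p] xs by (metis size_mset)
  obtain h where h: "bij_betw h (UNIV :: 'k set) {0..<CARD('k)}"
    using ex_bij_betw_finite_nat[OF finite_class.finite_UNIV] by blast
  have "p = (\<Prod>x\<in>#proots p. [:- x, 1:])"
    using complex_poly_decompose_multiset[of p] assms by simp
  also have "\<dots> = (\<Prod>x\<leftarrow>xs. [:- x, 1:])"
    by (simp flip: xs prod_mset_prod_list)
  also have "\<dots> = (\<Prod>i\<in>{0..<CARD('k)}. [:- (xs ! i), 1:])"
    by (simp add: prod.list_conv_set_nth len)
  also have "\<dots> = (\<Prod>i\<in>UNIV. [:- (xs ! h i), 1:])"
    by (rule prod.reindex_bij_betw[OF h, symmetric])
  finally show ?thesis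
    using that[of "\<chi> i. xs ! h i"] by simp
qed

lemma size_filter_image_mset_set:
  "finite I \<Longrightarrow> size {# z \<in># image_mset f (mset_set I). P z #} = card {i \<in> I. P (f i)}"
  by (simp add: filter_mset_image_mset)

text \<open>The roots are kept as a vector, so that along a sequence of parameters a subsequence
  of them converges; the limit is again a vector of roots, and no root can pass from \<open>F\<close> to \<open>G\<close>.\<close>

lemma root_count_constant:
  fixes p :: "real \<Rightarrow> complex poly" and F G :: "complex set"
  assumes deg: "\<And>t. t \<in> {0..1} \<Longrightarrow> degree (p t) = CARD('k::finite)"
    and monic: "\<And>t. t \<in> {0..1} \<Longrightarrow> lead_coeff (p t) = 1"
    and cont: "\<And>z. continuous_on {0..1} (\<lambda>t. poly (p t) z)"
    and bounded: "\<And>t z. t \<in> {0..1} \<Longrightarrow> poly (p t) z = 0 \<Longrightarrow> cmod z \<le> C"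
    and closed: "closed F" "closed G" and disj: "F \<inter> G = {}"
    and roots: "\<And>t z. t \<in> {0..1} \<Longrightarrow> poly (p t) z = 0 \<Longrightarrow> z \<in> F \<union> G"
  shows "size {# z \<in># proots (p 0). z \<in> F #} = size {# z \<in># proots (p 1). z \<in> F #}"
proof -
  define N where "N t = size {# z \<in># proots (p t). z \<in> F #}" for t
  have N_eq: "N t = card {i. f $ i \<in> F}" if "p t = (\<Prod>i\<in>UNIV. [:- (f $ i), 1:])" for t and f :: "complex^'k"
    unfolding N_def that by (subst proots_prod_linear) (auto simp: size_filter_image_mset_set)
  \<comment> \<open>Local constancy suffices because the interval is connected. A failure at
    \<open>t0\<close> gives parameters tending to \<open>t0\<close> with a different count.\<close>
  have local: "eventually (\<lambda>t. N t0 = N t) (at t0 within {0..1})" if t0: "t0 \<in> {0..1}" for t0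
  proof (rule ccontr)
    assume *: "\<not> eventually (\<lambda>t. N t0 = N t) (at t0 within {0..1})"
    have "\<exists>t. t \<in> {0..1} \<and> dist t t0 < inverse (Suc i) \<and> N t0 \<noteq> N t" for i
      using * unfolding eventually_at by (metis inverse_positive_iff_positive of_nat_0_less_iff zero_less_Suc)
    then obtain \<tau> where \<tau>: "\<And>i. \<tau> i \<in> {0..1}" "\<And>i. dist (\<tau> i) t0 < inverse (Suc i)" "\<And>i. N t0 \<noteq> N (\<tau> i)"
      by metis
    have "\<tau> \<longlonglongrightarrow> t0"
      unfolding tendsto_iff
    proof (intro allI impI)
      fix e :: real assume "0 < e"
      then have "eventually (\<lambda>i. inverse (real (Suc i)) < e) sequentially"
        using LIMSEQ_inverse_real_of_nat by (auto dest: order_tendstoD)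
      then show "eventually (\<lambda>i. dist (\<tau> i) t0 < e) sequentially"
        by eventually_elim (use \<tau>(2) less_trans in blast)
    qed
    have "\<exists>f :: complex^'k. p (\<tau> i) = (\<Prod>j\<in>UNIV. [:- (f $ j), 1:])" for i
      using monic_factorization[OF deg monic] \<tau>(1) by metis
    then obtain f :: "nat \<Rightarrow> complex^'k" where f: "\<And>i. p (\<tau> i) = (\<Prod>j\<in>UNIV. [:- (f i $ j), 1:])"
      by metis
    have root: "poly (p (\<tau> i)) (f i $ j) = 0" for i j
      unfolding f by (auto simp: poly_prod)
    have "norm (f i) \<le> real CARD('k) * C" for i
    proof -
      have "norm (f i) \<le> (\<Sum>j\<in>UNIV. cmod (f i $ j))"
        unfolding norm_vec_def by (rule L2_set_le_sum) simp
      also have "\<dots> \<le> real CARD('k) * C"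
        using bounded[OF \<tau>(1) root] by (rule sum_bounded_above)
      finally show ?thesis .
    qed
    then have "f i \<in> cball 0 (real CARD('k) * C)" for i
      by simp
    then obtain g \<rho> where \<rho>: "strict_mono (\<rho> :: nat \<Rightarrow> nat)" and g: "(f \<circ> \<rho>) \<longlonglongrightarrow> g"
      using compact_cball[of "0 :: complex^'k" "real CARD('k) * C"] unfolding compact_def by metis
    have g_nth: "(\<lambda>i. f (\<rho> i) $ j) \<longlonglongrightarrow> g $ j" for j
      using tendsto_vec_nth[OF g] by (simp add: o_def)
    have \<tau>\<rho>: "(\<lambda>i. \<tau> (\<rho> i)) \<longlonglongrightarrow> t0"
      using LIMSEQ_subseq_LIMSEQ[OF \<open>\<tau> \<longlonglongrightarrow> t0\<close> \<rho>] by (simp add: o_def)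
    \<comment> \<open>Both sides are limits, at each fixed point, of the factored polynomials along
      the subsequence.\<close>
    have pg: "p t0 = (\<Prod>j\<in>UNIV. [:- (g $ j), 1:])"
    proof (subst poly_eq_poly_eq_iff[symmetric], rule ext)
      fix x
      have "(\<lambda>i. poly (p (\<tau> (\<rho> i))) x) \<longlonglongrightarrow> poly (p t0) x"
        by (rule continuous_on_tendsto_compose[OF cont \<tau>\<rho> t0]) (simp add: \<tau>(1) del: atLeastAtMost_iff)
      moreover have "(\<lambda>i. poly (p (\<tau> (\<rho> i))) x) \<longlonglongrightarrow> (\<Prod>j\<in>UNIV. x - g $ j)"
      proof -
        have "(\<lambda>i. \<Prod>j\<in>UNIV. x - f (\<rho> i) $ j) \<longlonglongrightarrow> (\<Prod>j\<in>UNIV. x - g $ j)"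
          by (intro tendsto_prod tendsto_diff tendsto_const g_nth)
        then show ?thesis
          by (simp add: f poly_prod)
      qed
      ultimately show "poly (p t0) x = poly (\<Prod>j\<in>UNIV. [:- (g $ j), 1:]) x"
        using LIMSEQ_unique by (fastforce simp: poly_prod)
    qed
    \<comment> \<open>A limit in \<open>F\<close> avoids the closed set \<open>G\<close>, so nearby
      roots, confined to \<open>F \<union> G\<close>, are in \<open>F\<close>; a limit outside the
      closed set \<open>F\<close> has a neighbourhood outside it.\<close>
    have "eventually (\<lambda>i. f (\<rho> i) $ j \<in> F \<longleftrightarrow> g $ j \<in> F) sequentially" for j
    proof (cases "g $ j \<in> F")
      case True
      then have "g $ j \<in> - G"
        using disj by auto
      then have "eventually (\<lambda>i. f (\<rho> i) $ j \<in> - G) sequentially"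
        using closed g_nth by (intro topological_tendstoD) auto
      then show ?thesis
        by eventually_elim (use True roots[OF \<tau>(1) root] in auto)
    next
      case False
      then have "eventually (\<lambda>i. f (\<rho> i) $ j \<in> - F) sequentially"
        using closed g_nth by (intro topological_tendstoD) auto
      then show ?thesis
        by eventually_elim (use False in auto)
    qed
    then have "eventually (\<lambda>i. \<forall>j. f (\<rho> i) $ j \<in> F \<longleftrightarrow> g $ j \<in> F) sequentially"
      by (simp add: eventually_all_finite)
    then obtain i where "\<forall>j. f (\<rho> i) $ j \<in> F \<longleftrightarrow> g $ j \<in> F"
      using eventually_happens'[OF sequentially_bot] by blast
    then have "N (\<tau> (\<rho> i)) = N t0"
      by (simp add: N_eq[OF f] N_eq[OF pg])
    then show False
      using \<tau>(3)[of "\<rho> i"] by simp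
  qed
  have "N 0 = N 1"
    by (rule connected_local_const[of "{0..1 :: real}"]) (use local in auto)
  then show ?thesis
    by (simp add: N_def)
qed

subsection \<open>Determinants depending on a parameter\<close>

lemma tendsto_det:
  fixes M :: "'a \<Rightarrow> complex^'n^'n"
  assumes "\<And>i j. ((\<lambda>x. M x $ i $ j) \<longlongrightarrow> L $ i $ j) F"
  shows "((\<lambda>x. det (M x)) \<longlongrightarrow> det L) F"
  unfolding det_def by (intro tendsto_intros assms)

lemma det_scale: "det (\<chi> i j. c * M $ i $ j) = c ^ CARD('n) * det M" for M :: "complex^'n^'n"
  by (simp add: det_def prod.distrib sum_distrib_left mult_ac)

lemma poly_charpoly: "poly (charpoly M) z = det (mat z - M)"
proof -
  have "(\<chi> i j. poly ((\<chi> i j. (if i = j then [:0, 1:] else 0) - [:M $ i $ j:]) $ i $ j) z) = mat z - M"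
    by (auto simp: vec_eq_iff mat_def)
  then show ?thesis
    unfolding charpoly_def poly_det by simp
qed

lemma det_eq_0_iff: "det M = 0 \<longleftrightarrow> (\<exists>x. x \<noteq> 0 \<and> M *v x = 0)" for M :: "complex^'n^'n"
  using invertible_det_nz[of M] invertible_left_inverse[of M] matrix_left_invertible_ker[of M] by auto

text \<open>Taking a factor \<open>z\<close> out of each row leaves the determinant of 1 - M/z,
  which tends to 1.\<close>

lemma charpoly_monic:
  fixes M :: "complex^'n^'n"
  shows "degree (charpoly M) = CARD('n)" "lead_coeff (charpoly M) = 1"
proof -
  have "((\<lambda>z. poly (charpoly M) z / z ^ CARD('n)) \<longlongrightarrow> 1) at_infinity"
  proof (rule Lim_transform_eventually)
    have "((\<lambda>z. det (\<chi> i j. mat 1 $ i $ j - inverse z * M $ i $ j)) \<longlongrightarrow> det (mat 1 :: complex^'n^'n)) at_infinity"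
    proof (rule tendsto_det)
      fix i j :: 'n
      have "((\<lambda>z. mat 1 $ i $ j - inverse z * M $ i $ j) \<longlongrightarrow> mat 1 $ i $ j - 0 * M $ i $ j) at_infinity"
        by (intro tendsto_intros tendsto_inverse_0)
      then show "((\<lambda>z. (\<chi> i j. mat 1 $ i $ j - inverse z * M $ i $ j) $ i $ j) \<longlongrightarrow> mat 1 $ i $ j) at_infinity"
        by simp
    qed
    then show "((\<lambda>z. det (\<chi> i j. mat 1 $ i $ j - inverse z * M $ i $ j)) \<longlongrightarrow> 1) at_infinity"
      by simp
    have "det (mat z - M) = z ^ CARD('n) * det (\<chi> i j. mat 1 $ i $ j - inverse z * M $ i $ j)" if "z \<noteq> 0" for z
      unfolding det_scale[symmetric] using that
      by (intro arg_cong[of _ _ det]) (auto simp: vec_eq_iff mat_def algebra_simps)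
    then show "eventually (\<lambda>z. det (\<chi> i j. mat 1 $ i $ j - inverse z * M $ i $ j)
        = poly (charpoly M) z / z ^ CARD('n)) at_infinity"
      by (intro eventually_mono[OF eventually_not_equal_at_infinity[of 0]]) (simp add: poly_charpoly)
  qed
  then show "degree (charpoly M) = CARD('n)" "lead_coeff (charpoly M) = 1"
    by (rule degree_eqI_at_infinity)+
qed

lemma size_eigvals: "size (eigvals M) = CARD('n)" for M :: "complex^'n^'n"
  by (simp add: eigvals_def size_proots_complex charpoly_monic)

text \<open>For \<open>K = B ** adj B\<close> its roots are the eigenvalues of the quadratic
  problem. It is free of the Riccati solution, hence depends polynomially on \<open>t\<close> when
  \<open>A\<close> is scaled by \<open>t\<close>.\<close>

definition pencil_poly :: "complex^'n^'n \<Rightarrow> complex^'n^'n \<Rightarrow> complex poly" where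
  "pencil_poly A K = (let L = (\<chi> i j. [:A $ i $ j:] - (if i = j then [:0, 1:] else 0))
    in det (L ** L - (\<chi> i j. [:K $ i $ j:])))"

lemma poly_pencil_poly: "poly (pencil_poly A K) z = det ((A - mat z) ** (A - mat z) - K)"
  unfolding pencil_poly_def Let_def poly_det
  by (intro arg_cong[of _ _ det])
    (auto simp: vec_eq_iff matrix_matrix_mult_def mat_def poly_sum intro!: sum.cong)

lemma pencil_poly_root_iff:
  "poly (pencil_poly A K) z = 0 \<longleftrightarrow>
    (\<exists>y. y \<noteq> 0 \<and> A *v (A *v y) - (2 * z) *s (A *v y) + z\<^sup>2 *s y = K *v y)"
proof -
  have "((A - mat z) ** (A - mat z) - K) *v y = 0 \<longleftrightarrow>
      A *v (A *v y) - (2 * z) *s (A *v y) + z\<^sup>2 *s y = K *v y" for y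
    by (simp add: matrix_vector_mult_diff_rdistrib matrix_vector_mult_diff_distrib mat_mult_scale
        matrix_vector_scale flip: matrix_vector_mul_assoc)
      (auto simp: vec_eq_iff power2_eq_square algebra_simps)
  then show ?thesis
    by (simp add: poly_pencil_poly det_eq_0_iff)
qed

text \<open>As for \<open>charpoly_monic\<close>, with z^2 taken out of each row: (A/z - 1)^2 -
  K/z^2 tends to the identity.\<close>

lemma pencil_poly_monic:
  fixes A :: "complex^'n^'n"
  shows "degree (pencil_poly A K) = 2 * CARD('n)" "lead_coeff (pencil_poly A K) = 1"
proof -
  define R where "R z = (\<chi> i j. inverse z * A $ i $ j - mat 1 $ i $ j)" for z
  define T where "T z = (\<chi> i j. (R z ** R z) $ i $ j - inverse z * inverse z * K $ i $ j)" for z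
  have "((\<lambda>z. poly (pencil_poly A K) z / z ^ (2 * CARD('n))) \<longlongrightarrow> 1) at_infinity"
  proof (rule Lim_transform_eventually)
    have "((\<lambda>z. det (T z)) \<longlongrightarrow> det ((- mat 1) ** (- mat 1) :: complex^'n^'n)) at_infinity"
    proof (rule tendsto_det)
      fix i j :: 'n
      have "((\<lambda>z. T z $ i $ j) \<longlongrightarrow> (\<Sum>k\<in>UNIV. (0 * A $ i $ k - mat 1 $ i $ k) * (0 * A $ k $ j - mat 1 $ k $ j))
          - 0 * 0 * K $ i $ j) at_infinity"
        unfolding T_def R_def matrix_matrix_mult_def vec_lambda_beta
        by (intro tendsto_intros tendsto_inverse_0)
      then show "((\<lambda>z. T z $ i $ j) \<longlongrightarrow> ((- mat 1) ** (- mat 1)) $ i $ j) at_infinity"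
        by (simp add: matrix_matrix_mult_def)
    qed
    moreover have "(- mat 1) ** (- mat 1) = (mat 1 :: complex^'n^'n)"
      by (simp add: vec_eq_iff matrix_matrix_mult_def mat_def if_distrib[of "\<lambda>a. a * _"] cong: if_cong)
    ultimately show "((\<lambda>z. det (T z)) \<longlongrightarrow> 1) at_infinity"
      by simp
    have inv: "z * (z * (inverse z * (inverse z * x))) = x" if "z \<noteq> 0" for z x :: complex
      using that by (simp add: mult.assoc[symmetric])
    have "det ((A - mat z) ** (A - mat z) - K) = (z\<^sup>2) ^ CARD('n) * det (T z)" if "z \<noteq> 0" for z
      unfolding det_scale[symmetric]
    proof (intro arg_cong[of _ _ det])
      have "(A - mat z) $ i $ j = z * R z $ i $ j" for i j
        using that by (simp add: R_def mat_def algebra_simps)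
      then show "(A - mat z) ** (A - mat z) - K = (\<chi> i j. z\<^sup>2 * T z $ i $ j)"
        using that
        by (simp add: T_def vec_eq_iff matrix_matrix_mult_def power2_eq_square right_diff_distrib
            mult_ac inv sum_distrib_left)
    qed
    then show "eventually (\<lambda>z. det (T z) = poly (pencil_poly A K) z / z ^ (2 * CARD('n))) at_infinity"
      by (intro eventually_mono[OF eventually_not_equal_at_infinity[of 0]])
        (simp add: poly_pencil_poly power_mult)
  qed
  then show "degree (pencil_poly A K) = 2 * CARD('n)" "lead_coeff (pencil_poly A K) = 1"
    by (rule degree_eqI_at_infinity)+
qed

text \<open>In the product of \<open>z - (A + Y)\<close> and \<open>z - (A - Y)\<close> the terms
  linear in \<open>Y\<close> alone cancel, without \<open>A\<close> and \<open>Y\<close>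
  commuting.\<close>

lemma pencil_poly_factor:
  assumes "(A + Y) ** (A - Y) = A ** A - K"
  shows "pencil_poly A K = charpoly (A + Y) * charpoly (A - Y)"
proof (subst poly_eq_poly_eq_iff[symmetric], rule ext)
  fix z
  have "(A - mat z) ** (A - mat z) - K = (mat z - (A + Y)) ** (mat z - (A - Y))"
  proof -
    have "K = A ** A - (A + Y) ** (A - Y)"
      using assms by simp
    moreover have "((A - mat z) ** (A - mat z) - (A ** A - (A + Y) ** (A - Y))) *v x
        = ((mat z - (A + Y)) ** (mat z - (A - Y))) *v x" for x
      by (simp add: matrix_vector_mult_diff_rdistrib matrix_vector_mult_diff_distrib mat_mult_scale
          matrix_vector_scale matrix_vector_mult_add_rdistrib matrix_vector_right_distrib
          flip: matrix_vector_mul_assoc)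
    ultimately show ?thesis
      by (metis matrix_eq)
  qed
  then show "poly (pencil_poly A K) z = poly (charpoly (A + Y) * charpoly (A - Y)) z"
    by (simp add: poly_pencil_poly poly_charpoly det_mul)
qed

lemma charpoly_similar:
  assumes "det P \<noteq> 0" "P ** M = M' ** P"
  shows "charpoly M = charpoly M'"
proof (subst poly_eq_poly_eq_iff[symmetric], rule ext)
  fix z
  have "P ** (mat z - M) = (mat z - M') ** P"
  proof -
    have "(P ** (mat z - M)) *v x = ((mat z - M') ** P) *v x" for x
      using assms(2)
      by (simp add: matrix_vector_mult_diff_rdistrib matrix_vector_mult_diff_distrib mat_mult_scale
          matrix_vector_scale flip: matrix_vector_mul_assoc) (simp add: matrix_vector_mul_assoc)
    then show ?thesis
      by (simp add: matrix_eq)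
  qed
  then have "det P * det (mat z - M) = det (mat z - M') * det P"
    by (metis det_mul)
  then show "poly (charpoly M) z = poly (charpoly M') z"
    using assms(1) by (simp add: poly_charpoly)
qed

text \<open>For invertible \<open>X\<close> the two products are similar through \<open>X\<close>.
  In general \<open>X + mat e\<close> is invertible for small nonzero \<open>e\<close>, and the
  determinant is continuous.\<close>

lemma charpoly_mult_commute:
  fixes X Y :: "complex^'n^'n"
  shows "charpoly (X ** Y) = charpoly (Y ** X)"
proof (subst poly_eq_poly_eq_iff[symmetric], rule ext)
  fix z
  have entries: "((\<lambda>e. ((X + mat e) ** Y) $ i $ j) \<longlongrightarrow> (X ** Y) $ i $ j) (at 0)"
    "((\<lambda>e. (Y ** (X + mat e)) $ i $ j) \<longlongrightarrow> (Y ** X) $ i $ j) (at 0)" for i j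
  proof -
    have mat: "((\<lambda>e. mat e $ i $ j :: complex) \<longlongrightarrow> 0) (at 0)" for i j :: 'n
      by (cases "i = j") (simp_all add: mat_def)
    show "((\<lambda>e. ((X + mat e) ** Y) $ i $ j) \<longlongrightarrow> (X ** Y) $ i $ j) (at 0)"
      "((\<lambda>e. (Y ** (X + mat e)) $ i $ j) \<longlongrightarrow> (Y ** X) $ i $ j) (at 0)"
      unfolding matrix_matrix_mult_def vec_lambda_beta vector_add_component
      by (rule tendsto_eq_intros mat refl | simp)+
  qed
  have "((\<lambda>e. det (mat z - (X + mat e) ** Y)) \<longlongrightarrow> det (mat z - X ** Y)) (at 0)"
    by (rule tendsto_det) (auto intro!: tendsto_intros entries)
  moreover have "eventually (\<lambda>e. det (mat z - (X + mat e) ** Y) = det (mat z - Y ** (X + mat e))) (at 0)"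
  proof -
    have "finite {e. poly (charpoly (- X)) e = 0}"
      using charpoly_nonzero poly_roots_finite by blast
    \<comment> \<open>Removing 0 from the finite exceptional set keeps its complement a
      neighbourhood of 0 even when \<open>X\<close> is singular.\<close>
    then have "open (- ({e. poly (charpoly (- X)) e = 0} - {0}))"
      by (intro open_Compl finite_imp_closed finite_Diff)
    then have "eventually (\<lambda>e. e \<in> - ({e. poly (charpoly (- X)) e = 0} - {0})) (nhds 0)"
      by (rule eventually_nhds_in_open) simp
    then have "eventually (\<lambda>e. poly (charpoly (- X)) e \<noteq> 0) (at 0)"
      unfolding eventually_at_filter by eventually_elim auto
    then show ?thesis
    proof eventually_elim
      case (elim e)
      then have "det (X + mat e) \<noteq> 0"
        by (simp add: poly_charpoly add.commute)
      then have "charpoly (Y ** (X + mat e)) = charpoly ((X + mat e) ** Y)"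
        by (rule charpoly_similar) (simp add: matrix_mul_assoc)
      then show ?case
        by (simp flip: poly_charpoly)
    qed
  qed
  ultimately have "((\<lambda>e. det (mat z - Y ** (X + mat e))) \<longlongrightarrow> det (mat z - X ** Y)) (at 0)"
    by (rule Lim_transform_eventually)
  moreover have "((\<lambda>e. det (mat z - Y ** (X + mat e))) \<longlongrightarrow> det (mat z - Y ** X)) (at 0)"
    by (rule tendsto_det) (auto intro!: tendsto_intros entries)
  ultimately show "poly (charpoly (X ** Y)) z = poly (charpoly (Y ** X)) z"
    unfolding poly_charpoly by (rule tendsto_unique[OF at_neq_bot])
qed

subsection \<open>The spectrum of \<open>B B*\<close>\<close>

text \<open>For an eigenvector \<open>x\<close> put \<open>u = adj B *v x\<close>. Then
  \<open>g\<close> is the squared ratio of \<open>norm u\<close> to \<open>norm x\<close>, and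
  \<open>u\<close> is an eigenvector of \<open>adj B ** B\<close> for \<open>g\<close>, which bounds
  \<open>g\<close> below by \<sigma>^2.\<close>

lemma eigenvalue_mult_adj:
  fixes B :: "complex^'m^'n"
  assumes g: "eigenvalue (B ** adj B) g" and \<sigma>: "0 \<le> \<sigma>" "\<And>u. \<sigma> * norm u \<le> norm (B *v u)"
  shows "g = 0 \<or> (\<exists>x \<ge> \<sigma>. g = complex_of_real (x\<^sup>2))"
proof (cases "g = 0")
  case False
  obtain x where x: "x \<noteq> 0" "B *v (adj B *v x) = g *s x"
    using g unfolding eigenvalue_def by (auto simp: matrix_vector_mul_assoc)
  define u where "u = adj B *v x"
  have "g * (norm x)\<^sup>2 = complex_of_real ((norm u)\<^sup>2)"
    using cprod_adj[of x B u] x by (simp add: u_def cprod_scale cprod_self)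
  then have g_eq: "g = complex_of_real ((norm u)\<^sup>2 / (norm x)\<^sup>2)"
    using x(1) by (simp add: field_simps)
  have u: "u \<noteq> 0"
    using False g_eq by auto
  have "adj B *v (B *v u) = g *s u"
    using x(2) by (simp add: u_def matrix_vector_scale)
  then have "complex_of_real ((norm (B *v u))\<^sup>2) = g * complex_of_real ((norm u)\<^sup>2)"
    using cprod_adj_right[of u B "B *v u"] by (simp add: cprod_scale cprod_self)
  then have "complex_of_real ((norm (B *v u))\<^sup>2) = complex_of_real ((norm u)\<^sup>2 / (norm x)\<^sup>2 * (norm u)\<^sup>2)"
    unfolding g_eq by (simp only: of_real_mult)
  then have "(norm (B *v u))\<^sup>2 = (norm u / norm x)\<^sup>2 * (norm u)\<^sup>2"
    unfolding of_real_eq_iff by (simp only: power_divide)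
  moreover have "(\<sigma> * norm u)\<^sup>2 \<le> (norm (B *v u))\<^sup>2"
    using \<sigma> by (intro power_mono) auto
  ultimately have "\<sigma>\<^sup>2 \<le> (norm u / norm x)\<^sup>2"
    using u by (simp add: power_mult_distrib)
  then have "\<sigma> \<le> norm u / norm x"
    by (rule power2_le_imp_le) simp
  then show ?thesis
    using g_eq by (intro disjI2 exI[of _ "norm u / norm x"]) (simp add: power_divide)
qed simp

text \<open>\<open>B\<close> is padded with zero columns to a square matrix \<open>C\<close>; then \<open>B B*\<close> has the same
  characteristic polynomial as \<open>C* C\<close>, which is \<open>B* B\<close> bordered by zeros.\<close>

lemma order_0_charpoly_mult_adj:
  fixes B :: "complex^'m^'n"
  assumes ker: "{u. B *v u = 0} = {0}" and le: "CARD('m) \<le> CARD('n)"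
  shows "order 0 (charpoly (B ** adj B)) = CARD('n) - CARD('m)"
proof -
  obtain e :: "'m \<Rightarrow> 'n" where e: "inj e"
    using card_le_inj[of "UNIV :: 'm set" "UNIV :: 'n set"] le by auto
  define C :: "complex^'n^'n" where "C = (\<chi> i j. if j \<in> range e then B $ i $ (inv e j) else 0)"
  define G where "G = adj C ** C"
  have "(\<Sum>k\<in>UNIV. C $ i $ k * cnj (C $ j $ k)) = (\<Sum>k\<in>UNIV. B $ i $ k * cnj (B $ j $ k))" for i j
  proof -
    have "(\<Sum>k\<in>UNIV. C $ i $ k * cnj (C $ j $ k)) = (\<Sum>k\<in>range e. C $ i $ k * cnj (C $ j $ k))"
      by (rule sum.mono_neutral_right) (auto simp: C_def)
    also have "\<dots> = (\<Sum>k\<in>UNIV. B $ i $ k * cnj (B $ j $ k))"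
      by (subst sum.reindex[OF e]) (simp add: C_def e)
    finally show ?thesis .
  qed
  then have "C ** adj C = B ** adj B"
    by (simp add: vec_eq_iff matrix_matrix_mult_def adj_def)
  then have p_eq: "charpoly (B ** adj B) = charpoly G"
    unfolding G_def by (metis charpoly_mult_commute)
  have G_row: "G $ i $ j = 0" if "i \<notin> range e" for i j
    using that by (simp add: G_def matrix_matrix_mult_def adj_def C_def)
  \<comment> \<open>The rows of \<open>G\<close> off the range of \<open>e\<close> vanish, so those
    rows of \<open>mat w - G\<close> are \<open>w\<close> times unit rows; \<open>H\<close> is what
    remains after taking out these factors.\<close>
  define d :: "complex \<Rightarrow> 'n \<Rightarrow> complex" where "d w i = (if i \<in> range e then 1 else w)" for w i
  define H where "H = (\<chi> i j. (if i = j then (if i \<in> range e then [:0, 1:] else 1) else 0) - [:G $ i $ j:])"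
  have det_H: "poly (det H) w = det (\<chi> i j. (if i = j then (if i \<in> range e then w else 1) else 0) - G $ i $ j)" for w
    unfolding poly_det by (intro arg_cong[of _ _ det]) (simp add: H_def vec_eq_iff)
  have "poly (charpoly G) w = w ^ (CARD('n) - CARD('m)) * poly (det H) w" for w
  proof -
    have "mat w - G = (\<chi> i. d w i *s (\<chi> j. (if i = j then (if i \<in> range e then w else 1) else 0) - G $ i $ j))"
      by (auto simp: vec_eq_iff mat_def d_def G_row)
    then have "poly (charpoly G) w = prod (d w) UNIV * poly (det H) w"
      unfolding poly_charpoly det_H by (simp only: det_rows_mul)
    also have "prod (d w) UNIV = prod (d w) (- range e) * prod (d w) (range e)"
      by (metis Compl_eq_Diff_UNIV finite_class.finite_UNIV prod.subset_diff subset_UNIV)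
    also have "\<dots> = w ^ card (- range e)"
      by (simp add: d_def)
    also have "card (- range e) = CARD('n) - CARD('m)"
      by (simp add: Compl_eq_Diff_UNIV card_Diff_subset card_image[OF e])
    finally show ?thesis .
  qed
  then have fac: "charpoly G = [:- 0, 1:] ^ (CARD('n) - CARD('m)) * det H"
    by (intro poly_eq_poly_eq_iff[THEN iffD1] ext) simp
  \<comment> \<open>A kernel vector vanishes off the range of \<open>e\<close> and is killed by
    \<open>G\<close>, hence by \<open>C\<close>; its remaining entries then form a vector in the
    kernel of \<open>B\<close>.\<close>
  have "poly (det H) 0 \<noteq> 0"
  proof
    assume "poly (det H) 0 = 0"
    then obtain x where x: "x \<noteq> 0"
      and x0: "(\<chi> i j. (if i = j then (if i \<in> range e then 0 else 1) else 0) - G $ i $ j) *v x = 0"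
      unfolding det_H det_eq_0_iff by auto
    have row: "(if i \<in> range e then 0 else x $ i) - (G *v x) $ i = 0" for i
      using arg_cong[OF x0, of "\<lambda>v. v $ i"]
      by (cases "i \<in> range e")
        (simp_all add: matrix_vector_mult_def left_diff_distrib sum_subtractf
          if_distrib[of "\<lambda>a. a * _"] sum_negf cong: if_cong)
    have off: "x $ i = 0" if "i \<notin> range e" for i
      using row[of i] that G_row[OF that] by (simp add: matrix_vector_mult_def)
    have "(G *v x) $ i = 0" for i
      using row[of i] G_row[of i] by (cases "i \<in> range e") (auto simp: matrix_vector_mult_def)
    then have "G *v x = 0"
      by (simp add: vec_eq_iff)
    then have "cprod (C *v x) (C *v x) = 0"
      using cprod_adj_right[of x C "C *v x"] by (simp add: G_def matrix_vector_mul_assoc)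
    then have "C *v x = 0"
      by (simp add: cprod_self)
    moreover have "C *v x = B *v (\<chi> j. x $ e j)"
    proof -
      have "(\<Sum>k\<in>UNIV. C $ i $ k * x $ k) = (\<Sum>k\<in>range e. C $ i $ k * x $ k)" for i
        by (rule sum.mono_neutral_right) (auto simp: C_def)
      also have "\<dots> i = (\<Sum>k\<in>UNIV. B $ i $ k * x $ e k)" for i
        by (subst sum.reindex[OF e]) (simp add: C_def e)
      finally show ?thesis
        by (simp add: vec_eq_iff matrix_vector_mult_def)
    qed
    ultimately have "(\<chi> j. x $ e j) = 0"
      using ker by auto
    then have on: "x $ e j = 0" for j
      by (simp add: vec_eq_iff)
    have "x $ i = 0" for i
      using on off by (cases "i \<in> range e") auto
    then have "x = 0"
      by (simp add: vec_eq_iff)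
    then show False
      using x by simp
  qed
  then have "order 0 (det H) = 0" "det H \<noteq> 0"
    by (auto simp: order_0I)
  then show ?thesis
    unfolding p_eq fac using order_power_n_n[of "0 :: complex"] by (subst order_mult) auto
qed

text \<open>For \<open>A = 0\<close> the polynomial is \<open>p\<close> evaluated at z^2, with roots
  plus and minus \<open>x i\<close>. Each nonzero root of \<open>p\<close> is a^2 with
  \<open>a\<close> at least \<sigma> and contributes just -a to the half-plane; zero roots
  contribute nothing.\<close>

lemma count_roots_pencil_0:
  fixes B :: "complex^'m^'n"
  assumes ker: "{u. B *v u = 0} = {0}" and le: "CARD('m) \<le> CARD('n)"
    and \<sigma>: "0 < \<sigma>" "\<And>u. \<sigma> * norm u \<le> norm (B *v u)" and \<rho>: "0 < \<rho>" "\<rho> \<le> \<sigma>"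
  shows "size {# z \<in># proots (pencil_poly 0 (B ** adj B)). Re z \<le> - \<rho> #} = CARD('m)"
proof -
  define p where "p = charpoly (B ** adj B)"
  obtain g :: "complex^'n" where g: "p = (\<Prod>i\<in>UNIV. [:- (g $ i), 1:])"
    using monic_factorization charpoly_monic unfolding p_def by metis
  define x where "x i = csqrt (g $ i)" for i
  have proots_p: "proots p = image_mset (($) g) (mset_set UNIV)"
    unfolding g by (rule proots_prod_linear) simp
  have "poly p (g $ i) = 0" for i
    unfolding g by (auto simp: poly_prod)
  then have ev: "eigenvalue (B ** adj B) (g $ i)" for i
    unfolding p_def eigenvalue_iff_poly .
  have x_cases: "g $ i \<noteq> 0 \<longleftrightarrow> Re (- x i) \<le> - \<rho>" "\<not> Re (x i) \<le> - \<rho>" for i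
  proof -
    consider "g $ i = 0" | a where "a \<ge> \<sigma>" "g $ i = complex_of_real (a\<^sup>2)"
      using eigenvalue_mult_adj[OF ev, of \<sigma> i] \<sigma> by auto
    then have "g $ i = 0 \<and> x i = 0 \<or> g $ i \<noteq> 0 \<and> Re (x i) \<ge> \<sigma>"
    proof cases
      case 2
      then have "x i = complex_of_real a"
        using \<sigma> by (simp add: x_def csqrt_of_real_nonneg del: of_real_power)
      then show ?thesis
        using 2 \<sigma> by auto
    qed (simp add: x_def)
    then show "g $ i \<noteq> 0 \<longleftrightarrow> Re (- x i) \<le> - \<rho>" "\<not> Re (x i) \<le> - \<rho>"
      using \<rho> \<sigma> by auto
  qed
  have "pencil_poly 0 (B ** adj B) = (\<Prod>i\<in>UNIV. [:- x i, 1:]) * (\<Prod>i\<in>UNIV. [:- (- x i), 1:])"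
  proof (subst poly_eq_poly_eq_iff[symmetric], rule ext)
    fix z
    have "(0 - mat z) ** (0 - mat z) = (mat (z\<^sup>2) :: complex^'n^'n)"
      by (simp add: vec_eq_iff matrix_matrix_mult_def mat_def power2_eq_square
          if_distrib[of "\<lambda>a. a * _"] cong: if_cong)
    then have "poly (pencil_poly 0 (B ** adj B)) z = poly p (z\<^sup>2)"
      unfolding poly_pencil_poly p_def poly_charpoly by simp
    also have "\<dots> = (\<Prod>i\<in>UNIV. (z - x i) * (z + x i))"
      unfolding g poly_prod
      by (intro prod.cong refl) (simp add: x_def algebra_simps flip: power2_eq_square)
    finally show "poly (pencil_poly 0 (B ** adj B)) z
        = poly ((\<Prod>i\<in>UNIV. [:- x i, 1:]) * (\<Prod>i\<in>UNIV. [:- (- x i), 1:])) z"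
      by (simp add: poly_prod prod.distrib add.commute)
  qed
  then have "proots (pencil_poly 0 (B ** adj B))
      = image_mset x (mset_set UNIV) + image_mset (\<lambda>i. - x i) (mset_set UNIV)"
    by (subst (asm) (1 2) refl, simp only:)
      (subst proots_mult, simp, simp, simp only: proots_prod_linear[OF finite_class.finite_UNIV])
  then have "size {# z \<in># proots (pencil_poly 0 (B ** adj B)). Re z \<le> - \<rho> #}
      = card {i. Re (x i) \<le> - \<rho>} + card {i. Re (- x i) \<le> - \<rho>}"
    by (simp add: size_filter_image_mset_set del: uminus_complex.simps)
  also have "\<dots> = card {i. g $ i \<noteq> 0}"
    using x_cases by simp
  also have "\<dots> = CARD('n) - card {i. g $ i = 0}"
    by (subst card_Diff_subset[symmetric]) (auto intro: arg_cong[of _ _ card])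
  also have "card {i. g $ i = 0} = count (proots p) 0"
    unfolding proots_p count_image_mset by (auto simp: vimage_def intro: arg_cong[of _ _ card])
  also have "\<dots> = CARD('n) - CARD('m)"
    using order_0_charpoly_mult_adj[OF ker le] by (simp add: p_def charpoly_nonzero)
  finally show ?thesis
    using le by simp
qed

subsection \<open>The smallest singular value\<close>

lemma inner_eq_Re_cprod: "x \<bullet> y = Re (cprod x y)" for x y :: "complex^'n"
  by (simp add: inner_vec_def cprod_def inner_complex_def)

text \<open>The minimum \<open>s\<close> of \<open>norm (B *v x)\<close> on the unit sphere is
  itself a singular value, by the first-order condition at a minimizer \<open>u0\<close>.\<close>

lemma smallest_singular_value_le:
  fixes B :: "complex^'m^'n"
  shows "smallest_singular_value B * norm u \<le> norm (B *v u)"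
proof -
  have "continuous_on (sphere 0 1) (\<lambda>x. norm (B *v x))"
    by (intro continuous_intros linear_continuous_on matrix_vector_mul_bounded_linear)
  moreover have "sphere (0 :: complex^'m) 1 \<noteq> {}"
  proof -
    have "axis undefined 1 \<in> sphere (0 :: complex^'m) 1"
      by simp
    then show ?thesis by blast
  qed
  ultimately obtain u0 where u0: "u0 \<in> sphere 0 1"
    and min: "\<And>x. x \<in> sphere 0 1 \<Longrightarrow> norm (B *v u0) \<le> norm (B *v x)"
    using continuous_attains_inf[OF compact_sphere] by metis
  define s where "s = norm (B *v u0)"
  have ge: "s * norm x \<le> norm (B *v x)" for x
  proof (cases "x = 0")
    case False
    define x' where "x' = (1 / norm x) *\<^sub>R x"
    have "x' \<in> sphere 0 1"
      using False by (simp add: x'_def)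
    then have "s \<le> norm (B *v x')"
      using min by (simp add: s_def)
    also have "\<dots> = norm (B *v x) / norm x"
      by (simp add: x'_def linear_simps(5)[OF matrix_vector_mul_bounded_linear])
    finally show ?thesis
      using False by (simp add: field_simps)
  qed simp
  \<comment> \<open>Half the gradient at \<open>u0\<close> of norm (B x)^2 - s^2 (norm x)^2, a
    nonnegative function vanishing at \<open>u0\<close>.\<close>
  define h where "h = adj B *v (B *v u0) - complex_of_real (s\<^sup>2) *s u0"
  have "h = 0"
  proof (rule ccontr)
    assume "h \<noteq> 0"
    define a where "a = (norm h)\<^sup>2"
    define b where "b = (norm (B *v h))\<^sup>2 - s\<^sup>2 * (norm h)\<^sup>2"
    have a: "0 < a"
      using \<open>h \<noteq> 0\<close> by (simp add: a_def)
    have cross: "(B *v u0) \<bullet> (B *v h) - s\<^sup>2 * (u0 \<bullet> h) = a"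
    proof -
      have "(B *v u0) \<bullet> (B *v h) - s\<^sup>2 * (u0 \<bullet> h) = Re (cprod h h)"
        unfolding inner_eq_Re_cprod cprod_adj[of "B *v u0"]
        by (subst (2) h_def) (simp add: cprod_diff cprod_scale del: of_real_power)
      then show ?thesis
        by (simp add: cprod_self a_def del: of_real_power)
    qed
    have quadratic: "2 * \<epsilon> * a \<le> \<epsilon>\<^sup>2 * b" for \<epsilon> :: real
    proof -
      have "(s * norm (u0 - \<epsilon> *\<^sub>R h))\<^sup>2 \<le> (norm (B *v (u0 - \<epsilon> *\<^sub>R h)))\<^sup>2"
        by (intro power_mono ge) (simp add: s_def)
      then have "s\<^sup>2 * ((norm u0)\<^sup>2 - 2 * \<epsilon> * (u0 \<bullet> h) + \<epsilon>\<^sup>2 * (norm h)\<^sup>2)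
          \<le> (norm (B *v u0))\<^sup>2 - 2 * \<epsilon> * ((B *v u0) \<bullet> (B *v h)) + \<epsilon>\<^sup>2 * (norm (B *v h))\<^sup>2"
        unfolding power2_norm_eq_inner power_mult_distrib
        by (simp add: matrix_vector_mult_diff_distrib linear_simps(5)[OF matrix_vector_mul_bounded_linear] inner_diff_left
            inner_diff_right inner_commute algebra_simps power2_eq_square)
      moreover have "norm u0 = 1" "norm (B *v u0) = s"
        using u0 by (simp_all add: s_def)
      ultimately have "0 \<le> - (2 * \<epsilon> * ((B *v u0) \<bullet> (B *v h) - s\<^sup>2 * (u0 \<bullet> h))) + \<epsilon>\<^sup>2 * b"
        by (simp add: b_def algebra_simps)
      then show ?thesis
        unfolding cross by simp
    qed
    \<comment> \<open>With this step length the second-order term is at most \<epsilon> a, too small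
      against the first-order term 2 \<epsilon> a.\<close>
    have "2 * a \<le> a / (\<bar>b\<bar> + 1) * b"
    proof -
      define \<epsilon> where "\<epsilon> = a / (\<bar>b\<bar> + 1)"
      have "0 < \<epsilon>"
        using a by (simp add: \<epsilon>_def)
      moreover have "\<epsilon> * (2 * a) \<le> \<epsilon> * (\<epsilon> * b)"
        using quadratic[of \<epsilon>] by (simp add: power2_eq_square mult_ac)
      ultimately have "2 * a \<le> \<epsilon> * b"
        by (simp only: mult_le_cancel_left_pos)
      then show ?thesis
        unfolding \<epsilon>_def .
    qed
    also have "\<dots> \<le> a"
      using a by (simp add: pos_divide_le_eq)
    finally show False
      using a by simp
  qed
  then have "(adj B ** B) *v u0 = complex_of_real (s\<^sup>2) *s u0"
    by (simp add: h_def matrix_vector_mul_assoc)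
  moreover have "u0 \<noteq> 0"
    using u0 by auto
  ultimately have s: "singular_value B s"
    unfolding singular_value_def eigenvalue_def s_def by auto
  \<comment> \<open>Finiteness is what gives \<open>Min\<close> its meaning.\<close>
  have "{s. singular_value B s} \<subseteq> (\<lambda>z. sqrt (Re z)) ` {z. poly (charpoly (adj B ** B)) z = 0}"
  proof
    fix t assume "t \<in> {s. singular_value B s}"
    then show "t \<in> (\<lambda>z. sqrt (Re z)) ` {z. poly (charpoly (adj B ** B)) z = 0}"
      by (intro image_eqI[of _ _ "complex_of_real (t\<^sup>2)"])
        (simp_all add: singular_value_def eigenvalue_iff_poly del: of_real_power)
  qed
  then have "finite {s. singular_value B s}"
    by (rule finite_subset) (simp add: poly_roots_finite charpoly_nonzero)
  then have "smallest_singular_value B \<le> s"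
    unfolding smallest_singular_value_def using s by (intro Min_le) auto
  then have "smallest_singular_value B * norm u \<le> s * norm u"
    by (rule mult_right_mono) simp
  then show ?thesis
    using ge[of u] by linarith
qed

subsection \<open>The closed loop\<close>

locale riccati = eigenbasis A lam v n for A :: "complex^'n^'n" and lam v n +
  fixes B :: "complex^'m^'n" and X :: "complex^'n^'n"
  assumes sol: "lqr_riccati_solution A B X"
begin

abbreviation "Acl \<equiv> closed_loop A B X"

lemma X_adj: "adj X = X" and X_nonneg: "0 \<le> Re (cprod x (X *v x))"
  using sol unfolding lqr_riccati_solution_def nonneg_matrix_def by auto

lemma riccati: "X *v (B *v (adj B *v (X *v x))) - X *v (A *v x) + A *v (X *v x) = x"
proof -
  have "X ** B ** adj B ** X - X ** A - adj A ** X - mat 1 = 0"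
    using sol unfolding lqr_riccati_solution_def by auto
  then have "(X ** B ** adj B ** X - X ** A - adj A ** X - mat 1) *v x = 0"
    by simp
  then show ?thesis
    by (simp add: skew matrix_vector_mult_diff_rdistrib matrix_vector_minus flip: matrix_vector_mul_assoc)
qed

lemma Acl_mult: "Acl *v x = A *v x - B *v (adj B *v (X *v x))"
  by (simp add: closed_loop_def matrix_vector_mult_diff_rdistrib flip: matrix_vector_mul_assoc)

text \<open>The Riccati equation in intertwining form: once \<open>X\<close> is inverted, it makes
  the closed loop similar to \<open>A\<close> minus the inverse of \<open>X\<close>.\<close>

lemma X_Acl: "X *v (Acl *v x) = A *v (X *v x) - x"
  using riccati[of x] by (simp add: Acl_mult matrix_vector_mult_diff_distrib algebra_simps)

lemma cprod_A: "cprod x (A *v y) = - cprod (A *v x) y"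
  by (simp add: cprod_adj skew matrix_vector_minus cprod_minus)

lemma Re_cprod_A: "Re (cprod x (A *v x)) = 0"
  using arg_cong[OF cprod_A[of x x], of Re] cnj_cprod[of "A *v x" x]
  by (metis cnj.simps(1) eq_neg_iff_add_eq_0 mult_2 mult_eq_0_iff uminus_complex.simps(1) zero_neq_numeral)

text \<open>On the kernel of \<open>X\<close> the Riccati equation reads x = - X A x, and the range
  of the self-adjoint \<open>X\<close> is orthogonal to its kernel.\<close>

lemma X_injective:
  assumes "X *v x = 0" shows "x = 0"
proof -
  have "cprod x x = - cprod (X *v x) (A *v x)"
    using riccati[of x] assms
    by (metis X_adj add.right_neutral cprod_adj cprod_minus(1) diff_0 matrix_vector_mult_0_right)
  then show ?thesis
    using assms by (simp add: cprod_self)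
qed

text \<open>With y = X x, \<open>X_Acl\<close> gives x = (A - z) y and \<open>Acl_mult\<close> gives
  B (adj B) y = (A - z) x. Pairing the latter with \<open>y\<close> expresses the sum of the squared
  norms of \<open>adj B *v y\<close> and \<open>x\<close> as -2 Re z times the nonnegative form of
  \<open>X\<close> at \<open>x\<close>, so Re z is negative.\<close>

lemma eigenvalue_closed_loop:
  assumes "eigenvalue Acl z"
  obtains y where "y \<noteq> 0" "Re z < 0"
    "A *v (A *v y) - (2 * z) *s (A *v y) + z\<^sup>2 *s y = B *v (adj B *v y)"
proof -
  obtain x where x: "x \<noteq> 0" "Acl *v x = z *s x"
    using assms unfolding eigenvalue_def by blast
  define y where "y = X *v x"
  have xy: "x = A *v y - z *s y"
    using X_Acl[of x] by (simp add: x y_def matrix_vector_scale algebra_simps)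
  have By: "B *v (adj B *v y) = A *v x - z *s x"
    using Acl_mult[of x] by (simp add: x y_def algebra_simps)
  show ?thesis
  proof
    show "y \<noteq> 0"
      using X_injective x by (auto simp: y_def)
    show "A *v (A *v y) - (2 * z) *s (A *v y) + z\<^sup>2 *s y = B *v (adj B *v y)"
      unfolding By by (subst (1 2) xy)
        (simp add: matrix_vector_mult_diff_distrib matrix_vector_scale, simp add: vec_eq_iff
          power2_eq_square algebra_simps)
    define \<xi> where "\<xi> = cprod y x"
    have \<xi>: "\<xi> = cprod x (X *v x)"
      by (simp add: \<xi>_def y_def cprod_adj X_adj)
    have "cprod y (B *v (adj B *v y)) = - (cprod x x + cnj z * \<xi>) - z * \<xi>"
    proof -
      have "A *v y = x + z *s y"
        using xy by simp
      then have "cprod y (A *v x) = - (cprod x x + cnj z * \<xi>)"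
        by (simp add: cprod_A cprod_add cprod_scale \<xi>_def)
      then show ?thesis
        by (simp add: By cprod_diff cprod_scale \<xi>_def)
    qed
    then have "cprod (adj B *v y) (adj B *v y) = - cprod x x - (cnj z + z) * \<xi>"
      by (simp add: cprod_adj[of y B] ring_distribs)
    then have "complex_of_real ((norm (adj B *v y))\<^sup>2) = - complex_of_real ((norm x)\<^sup>2) - (cnj z + z) * \<xi>"
      unfolding cprod_self .
    then have "(norm (adj B *v y))\<^sup>2 = - (norm x)\<^sup>2 - 2 * Re z * Re \<xi>"
      by (auto simp: complex_eq_iff simp del: of_real_power)
    moreover have "0 < (norm x)\<^sup>2" "0 \<le> Re \<xi>"
      using x X_nonneg by (auto simp: \<xi>)
    ultimately have "Re z * Re \<xi> < 0"
      using zero_le_power2[of "norm (adj B *v y)"] by linarith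
    then show "Re z < 0"
      using \<open>0 \<le> Re \<xi>\<close> by (auto simp: mult_less_0_iff)
  qed
qed

text \<open>The Hautus test. Otherwise \<open>x\<close> would be orthogonal to the range of
  \<open>mat c - Acl\<close>, which is everything because the closed loop has no imaginary
  eigenvalue.\<close>

lemma adj_B_eigenvector_nonzero:
  assumes "x \<noteq> 0" "A *v x = (\<i> * complex_of_real t) *s x"
  shows "adj B *v x \<noteq> 0"
proof
  assume ker: "adj B *v x = 0"
  define c where "c = \<i> * complex_of_real t"
  have perp: "cprod x ((mat c - Acl) *v u) = 0" for u
    using assms(2)
    by (simp add: matrix_vector_mult_diff_rdistrib mat_mult_scale Acl_mult cprod_diff cprod_scale
        cprod_A cprod_adj[of x B] ker c_def)
  have "\<not> eigenvalue Acl c"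
    using eigenvalue_closed_loop[of c] by (auto simp: c_def)
  then have "det (mat c - Acl) \<noteq> 0"
    by (simp flip: eigenvalue_iff_poly poly_charpoly)
  then obtain N where "(mat c - Acl) ** N = mat 1"
    unfolding invertible_det_nz[symmetric] invertible_def by blast
  then have "(mat c - Acl) *v (N *v x) = x"
    by (simp add: matrix_vector_mul_assoc)
  then have "cprod x x = 0"
    using perp by metis
  then show False
    using assms(1) by (simp add: cprod_self)
qed

text \<open>A repeated eigenvalue would give a two-dimensional eigenspace, on which the
  scalar-valued \<open>adj B\<close> has a nonzero kernel vector.\<close>

lemma inj_on_lam_single:
  assumes e: "UNIV = {e :: 'm}"
  shows "inj_on lam {1..n}"
proof (rule inj_onI, rule ccontr)
  fix j k assume jk: "j \<in> {1..n}" "k \<in> {1..n}" "lam j = lam k" "j \<noteq> k"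
  define \<alpha> \<beta> where "\<alpha> = (adj B *v v k) $ e" and "\<beta> = (adj B *v v j) $ e"
  define x where "x = \<alpha> *s v j - \<beta> *s v k"
  have "v k \<noteq> 0"
    using norm_v[OF jk(2)] by auto
  then have "adj B *v v k \<noteq> 0"
    using A_v[OF jk(2)] by (rule adj_B_eigenvector_nonzero)
  then have "\<alpha> \<noteq> 0"
    using norm_vec_single[OF e, of "adj B *v v k"] by (auto simp: \<alpha>_def)
  moreover have "cprod (v j) x = \<alpha>"
    using jk orth[of j j] orth[of j k] by (simp add: x_def cprod_diff cprod_scale)
  ultimately have "x \<noteq> 0"
    by auto
  moreover have "A *v x = (\<i> * complex_of_real (lam k)) *s x"
    using A_v[OF jk(1)] A_v[OF jk(2)] jk(3)
    by (simp add: x_def matrix_vector_mult_diff_distrib matrix_vector_scale)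
      (simp add: vec_eq_iff algebra_simps)
  ultimately have "adj B *v x \<noteq> 0"
    by (rule adj_B_eigenvector_nonzero)
  moreover have "norm (adj B *v x) = 0"
    unfolding norm_vec_single[OF e]
    by (simp add: x_def matrix_vector_mult_diff_distrib matrix_vector_scale \<alpha>_def \<beta>_def)
  ultimately show False by simp
qed

text \<open>The extra factor belongs to \<open>A + Y\<close> with \<open>Y\<close> the inverse of
  \<open>X\<close>; its eigenvalues have nonnegative real part since \<open>A\<close> is skew and
  \<open>Y\<close> inherits nonnegativity from \<open>X\<close>.\<close>

lemma pencil_poly_eigvals:
  obtains P where "pencil_poly A (B ** adj B) = P * charpoly Acl" "P \<noteq> 0"
    "\<And>z. poly P z = 0 \<Longrightarrow> 0 \<le> Re z"
proof -
  have "\<exists>Y. Y ** X = mat 1"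
    unfolding matrix_left_invertible_ker using X_injective by blast
  then obtain Y where YX: "Y ** X = mat 1" by blast
  then have XY: "X ** Y = mat 1"
    by (simp add: matrix_left_right_inverse)
  have YXv: "Y *v (X *v x) = x" and XYv: "X *v (Y *v x) = x" for x
    by (simp_all add: matrix_vector_mul_assoc YX XY)
  have "((A + Y) ** (A - Y)) *v y = (A ** A - B ** adj B) *v y" for y
  proof -
    \<comment> \<open>Multiplying the Riccati equation by \<open>Y\<close> on both sides turns it
      into the factorization of A^2 - B (adj B).\<close>
    have "Y *v (X *v (B *v (adj B *v y)) - X *v (A *v (Y *v y)) + A *v y) = Y *v (Y *v y)"
      using riccati[of "Y *v y"] by (simp add: XYv)
    then have "B *v (adj B *v y) - A *v (Y *v y) + Y *v (A *v y) = Y *v (Y *v y)"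
      by (simp add: matrix_vector_mult_diff_distrib matrix_vector_right_distrib YXv)
    then show ?thesis
      by (simp add: matrix_vector_mult_diff_rdistrib matrix_vector_mult_diff_distrib
          matrix_vector_mult_add_rdistrib algebra_simps flip: matrix_vector_mul_assoc)
  qed
  then have "pencil_poly A (B ** adj B) = charpoly (A + Y) * charpoly (A - Y)"
    by (intro pencil_poly_factor) (simp add: matrix_eq)
  moreover have "charpoly Acl = charpoly (A - Y)"
  proof (rule charpoly_similar)
    show "det X \<noteq> 0"
      using X_injective by (auto simp: det_eq_0_iff)
    show "X ** Acl = (A - Y) ** X"
      by (simp add: matrix_eq matrix_vector_mult_diff_rdistrib X_Acl YXv flip: matrix_vector_mul_assoc)
  qed
  moreover have "0 \<le> Re z" if "poly (charpoly (A + Y)) z = 0" for z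
  proof -
    obtain y where y: "y \<noteq> 0" "(A + Y) *v y = z *s y"
      using \<open>poly (charpoly (A + Y)) z = 0\<close> unfolding eigenvalue_iff_poly eigenvalue_def by blast
    define x where "x = Y *v y"
    have "z * cprod y y = cprod y (A *v y) + cprod y x"
      using arg_cong[OF y(2), of "cprod y"]
      by (simp add: cprod_scale matrix_vector_mult_add_rdistrib cprod_add x_def)
    moreover have "cprod y x = cprod x (X *v x)"
      by (metis XYv X_adj cprod_adj x_def)
    ultimately have "z * complex_of_real ((norm y)\<^sup>2) = cprod y (A *v y) + cprod x (X *v x)"
      by (simp only: cprod_self)
    then have "Re z * (norm y)\<^sup>2 = Re (cprod x (X *v x))"
      by (auto simp: complex_eq_iff Re_cprod_A simp del: of_real_power)
    then have "0 \<le> Re z * (norm y)\<^sup>2"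
      using X_nonneg by simp
    then show ?thesis
      using y(1) by (simp add: zero_le_mult_iff)
  qed
  ultimately show ?thesis
    using that[of "charpoly (A + Y)"] charpoly_nonzero by metis
qed

end

section \<open>The homotopy from 0 to \<open>A\<close> and the count of fast eigenvalues\<close>

lemma (in eigenbasis) pencil_of_root:
  fixes B :: "complex^'m^'n"
  assumes "y \<noteq> 0" "Re z < 0"
    and "A *v (A *v y) - (2 * z) *s (A *v y) + z\<^sup>2 *s y = B *v (adj B *v y)"
  obtains y' where "pencil A lam v n B y' z"
proof
  define c where "c = complex_of_real (inverse (norm y))"
  show "pencil A lam v n B (c *s y) z"
  proof
    show "norm (c *s y) = 1"
      using assms(1) by (simp add: norm_vec_scale c_def norm_inverse)
    show "A *v (A *v (c *s y)) - (2 * z) *s (A *v (c *s y)) + z\<^sup>2 *s (c *s y)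
        = B *v (adj B *v (c *s y))"
      unfolding matrix_vector_scale assms(3)[symmetric]
      by (simp add: vec_eq_iff algebra_simps)
  qed fact
qed

lemma scaleR_matrix_mult: "(t *\<^sub>R M) *v x = complex_of_real t *s (M *v x)" for M :: "complex^'m^'n"
  by (simp add: vec_eq_iff matrix_vector_mult_def sum_distrib_left mult.assoc
      scaleR_conv_of_real[where 'a = complex])

lemma (in eigenbasis) eigenbasis_scale:
  assumes "0 \<le> t"
  shows "eigenbasis (t *\<^sub>R A) (\<lambda>j. t * lam j) v n"
proof
  show "adj (t *\<^sub>R A) = - (t *\<^sub>R A)"
  proof -
    have "adj (t *\<^sub>R A) = t *\<^sub>R adj A"
      by (simp add: adj_def vec_eq_iff)
    then show ?thesis
      by (simp add: skew)
  qed
  have "mono_on {1..CARD('n)} (\<lambda>j. t * lam j)"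
    using lam_mono assms by (auto simp: mono_on_def n_def intro!: mult_left_mono)
  moreover have "(t *\<^sub>R A) *v v j = (\<i> * complex_of_real (t * lam j)) *s v j" if "j \<in> {1..n}" for j
    unfolding scaleR_matrix_mult A_v[OF that] by (simp add: vec_eq_iff)
  ultimately show "skew_eigenbasis (t *\<^sub>R A) (\<lambda>j. t * lam j) v"
    unfolding skew_eigenbasis_def using orth by (auto simp: n_def)
qed (rule n_def)

text \<open>For larger \<open>z\<close> the map \<open>D\<close> expands every vector by at least
  \<open>opnorm K + 1\<close>, so \<open>D (D y)\<close> is too long to equal \<open>K *v y\<close>;
  the bound is uniform in \<open>t\<close>.\<close>

lemma pencil_root_bounded:
  fixes A K :: "complex^'n^'n"
  assumes t: "t \<in> {0..1}" and root: "poly (pencil_poly (t *\<^sub>R A) K) z = 0"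
  shows "cmod z \<le> opnorm A + opnorm K + 1"
proof (rule ccontr)
  assume large: "\<not> cmod z \<le> opnorm A + opnorm K + 1"
  define D where "D y = (t *\<^sub>R A) *v y - z *s y" for y
  obtain y where y: "y \<noteq> 0" "D (D y) = K *v y"
  proof -
    have "D (D y) = (t *\<^sub>R A) *v ((t *\<^sub>R A) *v y) - (2 * z) *s ((t *\<^sub>R A) *v y) + z\<^sup>2 *s y" for y
      unfolding D_def
      by (simp add: matrix_vector_mult_diff_distrib matrix_vector_scale, simp add: vec_eq_iff
          power2_eq_square algebra_simps)
    then show ?thesis
      using that root unfolding pencil_poly_root_iff by metis
  qed
  have D: "(opnorm K + 1) * norm x \<le> norm (D x)" for x
  proof -
    have "norm ((t *\<^sub>R A) *v x) = t * norm (A *v x)"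
      using t by (simp add: scaleR_matrix_mult norm_vec_scale)
    also have "\<dots> \<le> norm (A *v x)"
      using t by (intro mult_left_le_one_le) auto
    also have "\<dots> \<le> opnorm A * norm x"
      by (rule norm_mult_le_opnorm)
    finally have "cmod z * norm x - opnorm A * norm x \<le> norm (D x)"
      using norm_triangle_ineq2[of "z *s x" "(t *\<^sub>R A) *v x"]
      by (simp add: D_def norm_vec_scale norm_minus_commute)
    moreover have "(opnorm K + 1) * norm x \<le> (cmod z - opnorm A) * norm x"
      using large by (intro mult_right_mono) auto
    ultimately show ?thesis
      by (simp add: left_diff_distrib)
  qed
  have K: "0 \<le> opnorm K"
    by (rule opnorm_nonneg)
  have "opnorm K * norm y < (opnorm K + 1) * ((opnorm K + 1) * norm y)"
    using K y(1) by (simp add: algebra_simps add_pos_nonneg)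
  also have "\<dots> \<le> (opnorm K + 1) * norm (D y)"
    using D[of y] K by (intro mult_left_mono) auto
  also have "\<dots> \<le> opnorm K * norm y"
    using D[of "D y"] y(2) norm_mult_le_opnorm[of K y] by simp
  finally show False by simp
qed

lemma (in riccati) count_eigvals:
  assumes ker: "{u. B *v u = 0} = {0}" and le: "CARD('m) \<le> CARD('n)"
    and \<sigma>: "0 < \<sigma>" "\<And>u. \<sigma> * norm u \<le> norm (B *v u)"
    and gap: "sqrt 3 * (lam n - lam 1) < sqrt 6 / 4 * \<sigma>"
  shows "size {# z \<in># eigvals Acl. Re z \<le> - (sqrt 6 / 4 * \<sigma>) #} = CARD('m)"
proof -
  define \<rho> where "\<rho> = sqrt 6 / 4 * \<sigma>"
  define K where "K = B ** adj B"
  have \<rho>: "0 < \<rho>" "\<rho> \<le> \<sigma>"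
  proof -
    have "sqrt 6 \<le> 4"
      by (rule real_le_lsqrt) auto
    then have "sqrt 6 / 4 * \<sigma> \<le> 1 * \<sigma>"
      using \<sigma> by (intro mult_right_mono) auto
    then show "0 < \<rho>" "\<rho> \<le> \<sigma>"
      using \<sigma> by (auto simp: \<rho>_def)
  qed
  \<comment> \<open>Strictly below \<rho>, so that \<open>F\<close> and \<open>G\<close> are
    disjoint, and positive even when all eigenvalues of \<open>A\<close> coincide, so that roots
    outside \<open>G\<close> lie in the open left half-plane.\<close>
  define \<mu> where "\<mu> = (sqrt 3 * (lam n - lam 1) + \<rho>) / 2"
  have \<Delta>: "0 \<le> lam n - lam 1"
    using lam_mono[of 1 n] n_pos by simp
  then have \<mu>: "0 < \<mu>" "sqrt 3 * (lam n - lam 1) \<le> \<mu>" "\<mu> < \<rho>"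
    using gap[folded \<rho>_def] \<rho> by (auto simp: \<mu>_def intro: add_nonneg_pos)
  define p where "p t = pencil_poly (t *\<^sub>R A) K" for t
  define F G where "F = {z. Re z \<le> - \<rho>}" and "G = {z. Re z \<ge> - \<mu>}"
  \<comment> \<open>The type \<open>'n + 'n\<close> supplies one index for each of the 2n
    roots.\<close>
  have "size {# z \<in># proots (p 0). z \<in> F #} = size {# z \<in># proots (p 1). z \<in> F #}"
  proof (rule root_count_constant[where 'k = "'n + 'n" and G = G])
    show "degree (p t) = CARD('n + 'n)" "lead_coeff (p t) = 1" for t
      using pencil_poly_monic[of "t *\<^sub>R A" K] by (simp_all add: p_def)
    show "continuous_on {0..1} (\<lambda>t. poly (p t) z)" for z
      unfolding continuous_on_def p_def poly_pencil_poly
      by (intro ballI tendsto_det) (auto simp: matrix_matrix_mult_def intro!: tendsto_intros)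
    show "cmod z \<le> opnorm A + opnorm K + 1" if "t \<in> {0..1}" "poly (p t) z = 0" for t z
      using pencil_root_bounded that by (simp add: p_def)
    show "closed F" "closed G"
      unfolding F_def G_def by (auto intro!: closed_Collect_le continuous_intros)
    show "F \<inter> G = {}"
      using \<mu> by (auto simp: F_def G_def)
    show "z \<in> F \<union> G" if t: "t \<in> {0..1}" and root: "poly (p t) z = 0" for t z
    proof (cases "Re z < - \<mu>")
      case True
      interpret tA: eigenbasis "t *\<^sub>R A" "\<lambda>j. t * lam j" v n
        using t by (intro eigenbasis_scale) auto
      obtain y where "y \<noteq> 0"
        "(t *\<^sub>R A) *v ((t *\<^sub>R A) *v y) - (2 * z) *s ((t *\<^sub>R A) *v y) + z\<^sup>2 *s y = B *v (adj B *v y)"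
        using root unfolding p_def pencil_poly_root_iff K_def by (auto simp: matrix_vector_mul_assoc)
      moreover have "Re z < 0"
        using True \<mu> by simp
      ultimately obtain y' where "pencil (t *\<^sub>R A) (\<lambda>j. t * lam j) v n B y' z"
        using tA.pencil_of_root by metis
      then interpret pencil "t *\<^sub>R A" "\<lambda>j. t * lam j" v n B y' z .
      \<comment> \<open>Scaling by \<open>t\<close> only shrinks the spread, so the gap found for
        \<open>A\<close> serves all parameters.\<close>
      have "t * (lam n - lam 1) \<le> lam n - lam 1"
        using t \<Delta> by (intro mult_left_le_one_le) auto
      then have "sqrt 3 * (t * lam n - t * lam 1) \<le> sqrt 3 * (lam n - lam 1)"
        by (intro mult_left_mono) (auto simp: right_diff_distrib)
      then have "sqrt 3 * (t * lam n - t * lam 1) \<le> - Re z"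
        using \<mu>(2) True by linarith
      then have "sqrt 6 / 4 * \<sigma> \<le> - Re z"
        by (rule rate_dichotomy[OF \<sigma>])
      then show ?thesis
        by (simp add: F_def \<rho>_def)
    qed (simp add: G_def)
  qed
  moreover have "size {# z \<in># proots (p 0). z \<in> F #} = CARD('m)"
    using count_roots_pencil_0[OF ker le \<sigma> \<rho>] by (simp add: p_def F_def K_def)
  moreover have "{# z \<in># proots (p 1). z \<in> F #} = {# z \<in># eigvals Acl. z \<in> F #}"
  proof -
    obtain P where P: "p 1 = P * charpoly Acl" "P \<noteq> 0" "\<And>z. poly P z = 0 \<Longrightarrow> 0 \<le> Re z"
      using pencil_poly_eigvals by (auto simp: p_def K_def)
    have "{# z \<in># proots P. z \<in> F #} = {#}"
    proof -
      have "z \<notin> F" if "z \<in># proots P" for z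
        using that P \<rho> by (fastforce simp: F_def)
      then show ?thesis
        by simp
    qed
    then show ?thesis
      using P by (simp add: proots_mult charpoly_nonzero eigvals_def)
  qed
  ultimately show ?thesis
    by (simp add: F_def \<rho>_def)
qed

section \<open>Assembly of the three assertions\<close>

theorem theorem1:
  fixes A X A_cl :: "complex^'n^'n"
    and B :: "complex^'m^'n"
    and lam :: "nat \<Rightarrow> real"
    and v :: "nat \<Rightarrow> complex^'n"
    and n m :: nat
    and \<Delta> \<sigma> :: real
    and S :: "complex set"
  assumes n_def: "n = CARD('n)"
    and m_def: "m = CARD('m)"
    and n_ge_2: "2 \<le> n"
    and m_bounds: "1 \<le> m" "m \<le> n"
    and skew: "skew_hermitian A"
    and ker_B: "{u. B *v u = 0} = {0}"
    and stab: "stabilizable A B"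
    and eig: "skew_eigenbasis A lam v"
    and \<Delta>_def: "\<Delta> = lam n - lam 1"
    and \<sigma>_def: "\<sigma> = smallest_singular_value B"
    and X: "lqr_riccati_solution A B X"
    and A_cl_def: "A_cl = closed_loop A B X"
    and S_def: "S = complex_box {- opnorm B .. - (sqrt 6 / 4) * \<sigma>} {lam 1 .. lam n}"
  shows
    "(\<forall>z. eigenvalue A_cl z \<longrightarrow>
        z \<in> complex_box {- opnorm B ..< - l_est B lam v} {lam 1 .. lam n}) \<and>
     (\<sigma> > 2 * sqrt 2 * \<Delta> \<longrightarrow>
        size {# z \<in># eigvals A_cl. z \<in> S #} = m \<and>
        size {# z \<in># eigvals A_cl. z \<notin> S #} = n - m \<and>
        (\<forall>z \<in># eigvals A_cl. z \<notin> S \<longrightarrow>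
          z \<in> complex_box {- sqrt 3 * \<Delta> <..< - l_est B lam v} {lam 1 .. lam n})) \<and>
     (m = 1 \<longrightarrow>
        l_est B lam v < l1_est B lam v \<and>
        (\<forall>z. eigenvalue A_cl z \<longrightarrow>
          z \<in> complex_box {- opnorm B ..< - l1_est B lam v} {lam 1 .. lam n}) \<and>
        (\<sigma> > 2 * sqrt 2 * \<Delta> \<longrightarrow>
          size {# z \<in># eigvals A_cl. z \<in> S #} = m \<and>
          size {# z \<in># eigvals A_cl. z \<notin> S #} = n - m \<and>
          (\<forall>z \<in># eigvals A_cl. z \<notin> S \<longrightarrow>
            z \<in> complex_box {- sqrt 3 * \<Delta> <..< - l1_est B lam v} {lam 1 .. lam n})))"
proof -
  interpret riccati A lam v n B X
    using skew eig n_def X by unfold_locales (auto simp: skew_hermitian_def)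
  have ev_pencil: "\<exists>y. pencil A lam v n B y z" if "eigenvalue A_cl z" for z
  proof -
    obtain y where "y \<noteq> 0" "Re z < 0"
      "A *v (A *v y) - (2 * z) *s (A *v y) + z\<^sup>2 *s y = B *v (adj B *v y)"
      using eigenvalue_closed_loop \<open>eigenvalue A_cl z\<close> unfolding A_cl_def by metis
    then show ?thesis
      using pencil_of_root by metis
  qed
  have box: "- opnorm B \<le> Re z" "Re z < - l_est B lam v" "lam 1 \<le> Im z" "Im z \<le> lam n"
    if z: "eigenvalue A_cl z" for z
  proof -
    obtain y where "pencil A lam v n B y z"
      using ev_pencil[OF z] by blast
    then interpret pencil A lam v n B y z .
    show "- opnorm B \<le> Re z" "lam 1 \<le> Im z" "Im z \<le> lam n"
      using r_le_opnorm Im_bounds by auto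
    show "Re z < - l_est B lam v"
    proof (cases "inj_on lam {1..n}")
      case True
      obtain k where k: "k \<in> {1..n}"
        "norm (adj B *v v k) / (sqrt 2 * (1 + 2 * ((opnorm B)\<^sup>2 / (eig_gap n lam k)\<^sup>2))) < r"
        using rate_gt[OF n_ge_2 True] by blast
      have "l_est B lam v \<le> norm (adj B *v v k) / (sqrt 2 * (1 + 2 * ((opnorm B)\<^sup>2 / (eig_gap n lam k)\<^sup>2)))"
        unfolding l_est_def using True k(1) by (auto simp: n_def intro!: Min_le)
      then show ?thesis
        using k(2) by linarith
    next
      \<comment> \<open>Here \<open>l_est\<close> has its default value 0 and the claim is just that
        Re z is negative.\<close>
      case False
      then show ?thesis
        using Re_z by (simp add: l_est_def n_def)
    qed
  qed
  have box1: "Re z < - l1_est B lam v" if z: "eigenvalue A_cl z" and m: "m = 1" for z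
  proof -
    obtain e :: 'm where e: "UNIV = {e}"
      using m m_def card_1_singletonE by metis
    obtain y where "pencil A lam v n B y z"
      using ev_pencil[OF z] by blast
    then interpret pencil A lam v n B y z .
    \<comment> \<open>With a single input the eigenvalues are simple, so \<open>l1_est\<close> is
      the genuine minimum.\<close>
    have inj: "inj_on lam {1..n}"
      by (rule inj_on_lam_single[OF e])
    obtain k where k: "k \<in> {1..n}"
      "norm (adj B *v v k) / (sqrt 2 * sqrt (1 + 2 * ((opnorm B)\<^sup>2 / (eig_gap n lam k)\<^sup>2))) < r"
      using rate_gt_single[OF n_ge_2 inj e] by blast
    have "l1_est B lam v \<le> norm (adj B *v v k) / (sqrt 2 * sqrt (1 + 2 * ((opnorm B)\<^sup>2 / (eig_gap n lam k)\<^sup>2)))"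
      unfolding l1_est_def using inj k(1) by (auto simp: n_def intro!: Min_le)
    then show ?thesis
      using k(2) by linarith
  qed
  have l_less: "l_est B lam v < l1_est B lam v" if m: "m = 1"
  proof -
    obtain e :: 'm where e: "UNIV = {e}"
      using m m_def card_1_singletonE by metis
    have inj: "inj_on lam {1..n}"
      by (rule inj_on_lam_single[OF e])
    define f where "f k = norm (adj B *v v k) / (sqrt 2 * (1 + 2 * ((opnorm B)\<^sup>2 / (eig_gap n lam k)\<^sup>2)))" for k
    define g where "g k = norm (adj B *v v k) / (sqrt 2 * sqrt (1 + 2 * ((opnorm B)\<^sup>2 / (eig_gap n lam k)\<^sup>2)))" for k
    have f: "l_est B lam v = Min (f ` {1..n})" and g: "l1_est B lam v = Min (g ` {1..n})"
      using inj by (simp_all add: l_est_def l1_est_def f_def g_def n_def)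
    \<comment> \<open>Comparing at a minimizer of \<open>g\<close> is enough; strictness there needs
      \<open>adj B *v v k\<close> nonzero and \<open>sqrt x < x\<close> for \<open>x\<close> above
      1.\<close>
    have "Min (g ` {1..n}) \<in> g ` {1..n}"
      using n_pos by (intro Min_in) auto
    then obtain k where k: "k \<in> {1..n}" "l1_est B lam v = g k"
      using g by auto
    have "l_est B lam v \<le> f k"
      unfolding f using k(1) by (intro Min_le) auto
    also have "f k < g k"
    proof -
      have "v k \<noteq> 0"
        using norm_v[OF k(1)] by auto
      then have b: "0 < norm (adj B *v v k)"
        using adj_B_eigenvector_nonzero[OF _ A_v[OF k(1)]] by simp
      then have "0 < opnorm B"
        using norm_adj_mult_le[of B "v k"] norm_v[OF k(1)] by (metis less_le_trans mult.right_neutral)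
      moreover have "0 < eig_gap n lam k"
        using eig_gap_pos k(1) n_ge_2 inj by blast
      ultimately have x: "1 < 1 + 2 * ((opnorm B)\<^sup>2 / (eig_gap n lam k)\<^sup>2)"
        by simp
      have "sqrt x < x" if "1 < x" for x :: real
        using that by (intro real_less_lsqrt) (auto simp: power2_eq_square)
      from this[OF x] show ?thesis
        unfolding f_def g_def using b x
        by (intro divide_strict_left_mono mult_strict_left_mono mult_pos_pos) auto
    qed
    finally show ?thesis
      using k(2) by simp
  qed
  have part2: "size {# z \<in># eigvals A_cl. z \<in> S #} = m"
    "size {# z \<in># eigvals A_cl. z \<notin> S #} = n - m"
    "\<And>z. z \<in># eigvals A_cl \<Longrightarrow> z \<notin> S \<Longrightarrow> - sqrt 3 * \<Delta> < Re z"
    if large: "\<sigma> > 2 * sqrt 2 * \<Delta>"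
  proof -
    have "0 \<le> \<Delta>"
      using lam_mono[of 1 n] n_pos by (simp add: \<Delta>_def)
    then have \<sigma>: "0 < \<sigma>"
      using large by (meson mult_nonneg_nonneg order_le_less_trans real_sqrt_ge_zero zero_le_numeral)
    have \<sigma>_le: "\<sigma> * norm u \<le> norm (B *v u)" for u
      unfolding \<sigma>_def by (rule smallest_singular_value_le)
    \<comment> \<open>This identity converts the threshold \<open>2 * sqrt 2 * \<Delta>\<close> for
      \<sigma> into the gap between \<open>sqrt 3 * \<Delta>\<close> and
      \<open>sqrt 6 / 4 * \<sigma>\<close>.\<close>
    have "sqrt 6 * sqrt 2 = 2 * sqrt 3"
      using real_sqrt_mult[of 4 3] by (simp flip: real_sqrt_mult)
    then have "sqrt 3 * \<Delta> = sqrt 6 / 4 * (2 * sqrt 2 * \<Delta>)"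
      by (simp add: mult.assoc[symmetric])
    also have "\<dots> < sqrt 6 / 4 * \<sigma>"
      using large by (intro mult_strict_left_mono) auto
    finally have gap: "sqrt 3 * (lam n - lam 1) < sqrt 6 / 4 * \<sigma>"
      unfolding \<Delta>_def .
    \<comment> \<open>The other sides of the box hold for every eigenvalue by \<open>box\<close>, so
      only the right edge decides.\<close>
    have S_iff: "z \<in> S \<longleftrightarrow> Re z \<le> - (sqrt 6 / 4 * \<sigma>)" if "z \<in># eigvals A_cl" for z
      using box[of z] that by (auto simp: S_def complex_box_def in_eigvals_iff)
    have "{# z \<in># eigvals A_cl. z \<in> S #} = {# z \<in># eigvals A_cl. Re z \<le> - (sqrt 6 / 4 * \<sigma>) #}"
      using S_iff by (intro filter_mset_cong) auto
    also have "size \<dots> = m"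
      using count_eigvals[OF ker_B _ \<sigma> \<sigma>_le gap] m_bounds by (simp add: A_cl_def m_def n_def)
    finally show size_S: "size {# z \<in># eigvals A_cl. z \<in> S #} = m" .
    have "size (eigvals A_cl) = size {# z \<in># eigvals A_cl. z \<in> S #} + size {# z \<in># eigvals A_cl. z \<notin> S #}"
      by (metis multiset_partition size_union)
    then show "size {# z \<in># eigvals A_cl. z \<notin> S #} = n - m"
      using size_S size_eigvals[of A_cl] by (simp add: n_def)
    show "- sqrt 3 * \<Delta> < Re z" if z: "z \<in># eigvals A_cl" "z \<notin> S" for z
    proof -
      obtain y where "pencil A lam v n B y z"
        using ev_pencil z by (auto simp: in_eigvals_iff)
      then interpret pencil A lam v n B y z .
      have "\<not> sqrt 6 / 4 * \<sigma> \<le> r"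
        using S_iff z by auto
      then have "\<not> sqrt 3 * (lam n - lam 1) \<le> r"
        using rate_dichotomy[OF \<sigma> \<sigma>_le] by blast
      then show ?thesis
        by (simp add: \<Delta>_def)
    qed
  qed
  show ?thesis
    using box box1 l_less part2 by (auto simp: complex_box_def in_eigvals_iff)
qed

end
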